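(* Let $G=(V_P\cup V_L,E)$ be a point-line graph with $|V_P|\ge1$ and $|V_L|\ge2$, and let $T$ be the edge set of a tree with vertex set $V_L$. Then the following are equivalent: (a) $G$ can be realised as a point-line framework in $\mathbb{R}^2$ which is minimally infinitesimally fixed-normal rigid; (b) $G+T$ can be realised as an infinitesimally rigid bar-joint framework in $\mathbb{R}^2$ such that the points assigned to $V_L$ are collinear; (c) $|E|=2|V_P|+|V_L|-2$, $|F|\le 2\nu_{V_P}(F)-3$ for all $\emptyset\ne F\subseteq E$ with $\nu_{V_L}(F)=0$, and $|F|\le2\nu_{V_P}(F)+\nu_{V_L}(F)-2$ for all $\emptyset\ne F\subseteq E$.
   Context: A point-line graph is a graph whose vertex set is partitioned into $V_P$ (points) and $V_L$ (lines); its edges split into $E_{PP},E_{PL},E_{LL}$ by endpoint types. $\nu_Y(F)$ is the number of vertices of $Y$ incident to edges of $F$. $G+T$ is the graph on $V_P\cup V_L$ with edge set $E\cup T$. A point-line framework $(G,p,\ell)$ in $\mathbb{R}^2$ has $p:V_P\to\mathbb{R}^2$, $\ell=(a,r):V_L\to\mathbb{S}^1\times\mathbb{R}$, line $j$ being $\{x:\langle x,a_j\rangle+r_j=0\}$. It is infinitesimally fixed-normal rigid if the solution space of $\langle p_i-p_j,\dot p_i-\dot p_j\rangle=0$ ($ij\in E_{PP}$), $\langle\dot p_i,a_j\rangle+\dot r_j=0$ ($ij\in E_{PL}$, $i\in V_P$, $j\in V_L$), in unknowns $\dot p:V_P\to\mathbb{R}^2$, $\dot r:V_L\to\mathbb{R}$,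 has dimension $2$; minimally so if moreover deleting any edge destroys this property. A bar-joint framework $(H,q)$ in $\mathbb{R}^2$ is infinitesimally rigid if the solutions $\dot q$ of $\langle q_i-q_j,\dot q_i-\dot q_j\rangle=0$ ($ij\in E(H)$) form a space of dimension $3$.
   Formalization: In (b), "infinitesimally rigid" is replaced by "minimally infinitesimally rigid" (deleting any edge of G+T destroys rigidity), and E and T are required to share no edge; without this (b) does not imply (a) or (c), e.g. when G+T is the complete graph on 2 points and 2 lines. *)

theory Defs
  imports "HOL-Analysis.Analysis"
begin

text \<open>
  The vertex set of a point-line graph is the disjoint union of the finite index types
  \<open>'p\<close> (the points, embedded by \<open>Inl\<close>) and \<open>'l\<close> (the lines, embedded by \<open>Inr\<close>).  Edges are
  two-element sets of vertices.
\<close>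

abbreviation V_P :: "('p + 'l) set" where
  "V_P \<equiv> range Inl"

abbreviation V_L :: "('p + 'l) set" where
  "V_L \<equiv> range Inr"

definition simple_graph :: "'v set \<Rightarrow> 'v set set \<Rightarrow> bool" where
  "simple_graph V E \<longleftrightarrow> (\<forall>e\<in>E. e \<subseteq> V \<and> card e = 2)"

definition connected_graph :: "'v set \<Rightarrow> 'v set set \<Rightarrow> bool" where
  "connected_graph V E \<longleftrightarrow> (\<forall>u\<in>V. \<forall>v\<in>V. (u, v) \<in> {(x, y). {x, y} \<in> E}\<^sup>*)"

definition is_cycle :: "'v set set \<Rightarrow> 'v list \<Rightarrow> bool" where
  "is_cycle E c \<longleftrightarrow> 3 \<le> length c \<and> distinct c \<and>
     (\<forall>i. Suc i < length c \<longrightarrow> {c ! i, c ! Suc i} \<in> E) \<and> {last c, hd c} \<in> E"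

definition is_tree :: "'v set \<Rightarrow> 'v set set \<Rightarrow> bool" where
  "is_tree V E \<longleftrightarrow>
     V \<noteq> {} \<and> simple_graph V E \<and> connected_graph V E \<and> (\<nexists>c. is_cycle E c)"

definition nu :: "'v set \<Rightarrow> 'v set set \<Rightarrow> nat" where
  "nu Y F = card {v\<in>Y. \<exists>e\<in>F. v \<in> e}"


text \<open>
  Line \<open>j\<close> of a framework is given by \<open>l j = (a, r)\<close> and is the line \<open>{x. x \<bullet> a + r = 0}\<close>.
  A framework need not satisfy any incidences: an edge between a point and a line prescribes
  their distance.
\<close>

definition point_line_framework ::
  "('p + 'l) set set \<Rightarrow> ('p \<Rightarrow> real^2) \<Rightarrow> ('l \<Rightarrow> (real^2) \<times> real) \<Rightarrow> bool" where
  "point_line_framework E p l \<longleftrightarrow> simple_graph UNIV E \<and> (\<forall>j. norm (fst (l j)) = 1)"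

definition fixed_normal_motions ::
  "('p::finite + 'l::finite) set set \<Rightarrow> ('p \<Rightarrow> real^2) \<Rightarrow> ('l \<Rightarrow> (real^2) \<times> real)
     \<Rightarrow> (((real^2)^'p) \<times> (real^'l)) set" where
  "fixed_normal_motions E p l =
     {(p', r').
        (\<forall>i j. {Inl i, Inl j} \<in> E \<longrightarrow> (p i - p j) \<bullet> (p' $ i - p' $ j) = 0) \<and>
        (\<forall>i j. {Inl i, Inr j} \<in> E \<longrightarrow> p' $ i \<bullet> fst (l j) + r' $ j = 0)}"

definition inf_fixed_normal_rigid ::
  "('p::finite + 'l::finite) set set \<Rightarrow> ('p \<Rightarrow> real^2) \<Rightarrow> ('l \<Rightarrow> (real^2) \<times> real) \<Rightarrow> bool" where
  "inf_fixed_normal_rigid E p l \<longleftrightarrow> dim (fixed_normal_motions E p l) = 2"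

definition min_inf_fixed_normal_rigid ::
  "('p::finite + 'l::finite) set set \<Rightarrow> ('p \<Rightarrow> real^2) \<Rightarrow> ('l \<Rightarrow> (real^2) \<times> real) \<Rightarrow> bool" where
  "min_inf_fixed_normal_rigid E p l \<longleftrightarrow>
     inf_fixed_normal_rigid E p l \<and> (\<forall>e\<in>E. \<not> inf_fixed_normal_rigid (E - {e}) p l)"


definition bar_joint_motions ::
  "'v::finite set set \<Rightarrow> ('v \<Rightarrow> real^2) \<Rightarrow> ((real^2)^'v) set" where
  "bar_joint_motions H q =
     {q'. \<forall>i j. {i, j} \<in> H \<longrightarrow> (q i - q j) \<bullet> (q' $ i - q' $ j) = 0}"

definition inf_rigid :: "'v::finite set set \<Rightarrow> ('v \<Rightarrow> real^2) \<Rightarrow> bool" where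
  "inf_rigid H q \<longleftrightarrow> dim (bar_joint_motions H q) = 3"

definition min_inf_rigid :: "'v::finite set set \<Rightarrow> ('v \<Rightarrow> real^2) \<Rightarrow> bool" where
  "min_inf_rigid H q \<longleftrightarrow> inf_rigid H q \<and> (\<forall>e\<in>H. \<not> inf_rigid (H - {e}) q)"

end

theory Submission
  imports Defs
begin

text \<open>
  The counts are necessary because the rows of a minimally rigid framework are linearly independent
  and orthogonal to the trivial motions.  For sufficiency, give each edge the plane spanned by the
  possible values of its row, with the velocity components of \<open>V_L\<close> along their common line
  discarded (the tree \<open>T\<close> takes care of these).  A hyperplane meets the plane of each edge in the
  row of a framework with \<open>V_L\<close> on a line, and by the linear case of Lovasz's theorem on Dilworth
  truncation the rows of a generic hyperplane are independent exactly under the sparsity counts.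
  A projective map sending that line to infinity then turns the collinear points into line
  directions, which gives the point-line framework.
\<close>

text \<open>Points forced onto a line are not generic, so genericity is imposed on an object that
  has the collinearity built in: the normal h of a hyperplane. The section of the plane of an edge
  orthogonal to h has as coefficients the difference of the values of h at the two ends, turned by a
  right angle; the turned values of h are the positions q. At V_L the projection removes the first
  component of h too, and after the turn this is the second coordinate of q: ignoring tangential
  velocities is what puts V_L on a line. The constants have one origin. For a connected edge set the
  planes span dimension 2 nu_P - 2 if no line is covered and 2 nu_P + nu_L - 1 otherwise, because
  V_L grounds the first component. Truncation takes off one more, which gives the 3 and the 2 of
  (c). The truncation theorem is proved by variation: moving h breaks a circuit of sections, because
  sections are alternating in h and a test vector.\<close>

section \<open>Finite trees\<close>

definition is_path :: "'v set set \<Rightarrow> 'v \<Rightarrow> 'v \<Rightarrow> 'v list \<Rightarrow> bool" where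
  "is_path E x y c \<longleftrightarrow> c \<noteq> [] \<and> distinct c \<and> hd c = x \<and> last c = y \<and>
     (\<forall>i. Suc i < length c \<longrightarrow> {c ! i, c ! Suc i} \<in> E)"

lemma is_path_mono: "is_path E x y c \<Longrightarrow> E \<subseteq> E' \<Longrightarrow> is_path E' x y c"
  by (auto simp: is_path_def)

lemma is_path_snoc:
  assumes "is_path E x y c" "{y, z} \<in> E" "z \<notin> set c"
  shows "is_path E x z (c @ [z])"
proof -
  have c: "c \<noteq> []" "distinct c" "hd c = x" "last c = y"
    "\<And>i. Suc i < length c \<Longrightarrow> {c ! i, c ! Suc i} \<in> E"
    using assms(1) by (auto simp: is_path_def)
  have "{(c @ [z]) ! i, (c @ [z]) ! Suc i} \<in> E" if "Suc i < length (c @ [z])" for i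
  proof (cases "Suc i < length c")
    case True
    then show ?thesis using c(5) by (simp add: nth_append)
  next
    case False
    then have "i = length c - 1" "Suc i = length c" using that c(1) by auto
    then show ?thesis using c(1,4) assms(2) by (simp add: nth_append last_conv_nth)
  qed
  then show ?thesis using c assms(3) by (auto simp: is_path_def)
qed

lemma is_path_rev:
  assumes "is_path E x y c"
  shows "is_path E y x (rev c)"
proof -
  have "{rev c ! i, rev c ! Suc i} \<in> E" if "Suc i < length (rev c)" for i
  proof -
    let ?k = "length c - Suc (Suc i)"
    have "{c ! ?k, c ! Suc ?k} \<in> E" using assms that by (simp add: is_path_def)
    moreover have "Suc ?k = length c - Suc i" using that by simp
    ultimately show ?thesis using that by (simp add: rev_nth insert_commute)
  qed
  then show ?thesis using assms by (auto simp: is_path_def hd_rev last_rev)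
qed

lemma connected_graph_leaving_edge:
  assumes "connected_graph V E" "x \<in> S" "S \<subseteq> V" "y \<in> V - S"
  obtains u v where "u \<in> S" "v \<notin> S" "{u, v} \<in> E"
proof -
  have "(x, y) \<in> {(x, y). {x, y} \<in> E}\<^sup>*"
    using assms by (auto simp: connected_graph_def)
  then have "y \<notin> S \<longrightarrow> (\<exists>u v. u \<in> S \<and> v \<notin> S \<and> {u, v} \<in> E)"
    by (induction rule: rtrancl_induct) (use assms(2) in auto)
  then show ?thesis using assms(4) that by blast
qed

text \<open>A tree is grown vertex by vertex along an edge leaving S. The paths are kept inside S so
  that the new vertex is not on them and may be appended.\<close>

lemma connected_graph_grow_subtree:
  assumes fin: "finite V" and con: "connected_graph V E" and sg: "simple_graph V E"
    and n: "Suc n \<le> card V"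
  shows "\<exists>S E'. S \<subseteq> V \<and> E' \<subseteq> E \<and> card S = Suc n \<and> finite E' \<and> card E' = n \<and> (\<Union>E') \<subseteq> S \<and>
    (\<forall>x\<in>S. \<forall>y\<in>S. \<exists>c. set c \<subseteq> S \<and> is_path E' x y c)"
  using n
proof (induction n)
  case 0
  then obtain x where "x \<in> V" by fastforce
  then show ?case
    by (intro exI[of _ "{x}"] exI[of _ "{}"]) (auto simp: is_path_def intro!: exI[of _ "[x]"])
next
  case (Suc n)
  then obtain S E' where S: "S \<subseteq> V" "E' \<subseteq> E" "card S = Suc n" "finite E'" "card E' = n" "(\<Union>E') \<subseteq> S"
    and P: "\<And>x y. x \<in> S \<Longrightarrow> y \<in> S \<Longrightarrow> \<exists>c. set c \<subseteq> S \<and> is_path E' x y c"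
    by auto
  have finS: "finite S" using S(1) fin finite_subset by blast
  obtain x where x: "x \<in> S" using S(3) by fastforce
  have "S \<noteq> V" using S(3) Suc.prems by auto
  then obtain y where "y \<in> V - S" using S(1) by blast
  with con x S(1) obtain u v where uv: "u \<in> S" "v \<notin> S" "{u, v} \<in> E"
    using connected_graph_leaving_edge by metis
  have vV: "v \<in> V" using sg uv(3) by (auto simp: simple_graph_def)
  let ?S = "insert v S" and ?E = "insert {u, v} E'"
  have to_v: "\<exists>c. set c \<subseteq> ?S \<and> is_path ?E z v c" if "z \<in> S" for z
  proof -
    obtain c where "set c \<subseteq> S" "is_path E' z u c" using P[of z u] \<open>z \<in> S\<close> uv(1) by auto
    then have "is_path ?E z v (c @ [v])"
      using uv by (intro is_path_snoc[of _ _ u]) (auto intro: is_path_mono)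
    then show ?thesis using \<open>set c \<subseteq> S\<close> by (intro exI[of _ "c @ [v]"]) auto
  qed
  have "\<exists>c. set c \<subseteq> ?S \<and> is_path ?E a b c" if "a \<in> ?S" "b \<in> ?S" for a b
  proof -
    from that consider "a \<in> S" "b \<in> S" | "a \<in> S" "b = v" | "a = v" "b \<in> S" | "a = v" "b = v"
      by auto
    then show ?thesis
    proof cases
      case 1
      then show ?thesis using P[of a b] by (meson is_path_mono subset_insertI subset_trans)
    next
      case 2
      then show ?thesis using to_v by simp
    next
      case 3
      then obtain c where "set c \<subseteq> ?S" "is_path ?E b v c" using to_v by blast
      then show ?thesis using 3 is_path_rev by (intro exI[of _ "rev c"]) auto
    next
      case 4
      then show ?thesis by (intro exI[of _ "[v]"]) (auto simp: is_path_def)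
    qed
  qed
  moreover have "{u, v} \<notin> E'" using S(6) uv(2) by auto
  ultimately show ?case
    using S uv vV finS by (intro exI[of _ ?S] exI[of _ ?E]) auto
qed

text \<open>A grown subtree \<open>E'\<close> with \<open>card V - 1\<close> edges reaches all of V.
  A further edge of E would close the path of \<open>E'\<close> between its ends to a cycle.\<close>

lemma is_tree_card:
  assumes "finite V" "is_tree V E"
  shows "card E + 1 = card V"
proof -
  have V: "V \<noteq> {}" "simple_graph V E" "connected_graph V E" "\<nexists>c. is_cycle E c"
    using assms(2) by (auto simp: is_tree_def)
  define n where "n = card V - 1"
  have n: "Suc n = card V" using assms(1) V(1) by (simp add: n_def card_gt_0_iff)
  obtain S E' where S: "S \<subseteq> V" "E' \<subseteq> E" "card S = Suc n" "card E' = n"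
    and P: "\<forall>x\<in>S. \<forall>y\<in>S. \<exists>c. set c \<subseteq> S \<and> is_path E' x y c"
  proof -
    have "Suc n \<le> card V" using n by simp
    from connected_graph_grow_subtree[OF assms(1) V(3,2) this] show ?thesis
      using that by (elim exE conjE)
  qed
  have SV: "S = V" using S(1,3) n assms(1) by (metis card_subset_eq)
  have "E \<subseteq> E'"
  proof
    fix e assume e: "e \<in> E"
    then obtain x y where xy: "e = {x, y}" "x \<noteq> y" "x \<in> V" "y \<in> V"
      using V(2) by (auto simp: simple_graph_def card_2_iff)
    obtain c where c: "is_path E' x y c" using P xy(3,4) unfolding SV by blast
    show "e \<in> E'"
    proof (rule ccontr)
      assume ne: "e \<notin> E'"
      have c': "c \<noteq> []" "distinct c" "hd c = x" "last c = y"
        "\<And>i. Suc i < length c \<Longrightarrow> {c ! i, c ! Suc i} \<in> E'"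
        using c by (auto simp: is_path_def)
      \<comment> \<open>\<open>is_cycle\<close> asks for three vertices: a path with one would give
        x = y, a path with two would be the edge e itself.\<close>
      have "length c \<noteq> 1" using c' xy(2) by (auto simp: length_Suc_conv)
      moreover have "length c \<noteq> 2"
      proof
        assume "length c = 2"
        then have "c = [x, y]" using c'(3,4) by (auto simp: numeral_2_eq_2 length_Suc_conv)
        then show False using c'(5)[of 0] ne xy(1) by simp
      qed
      ultimately have "length c \<ge> 3" using c'(1) by (cases "length c") auto
      then have "is_cycle E c"
        using c' S(2) e xy(1) by (auto simp: is_cycle_def insert_commute)
      then show False using V(4) by blast
    qed
  qed
  then show ?thesis using S(2,4) n by auto
qed

section \<open>Dimension counts\<close>

text \<open>Families rather than sets: two edges may have the same row, and that must count as a
  dependence.\<close>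

definition indep_family :: "'e set \<Rightarrow> ('e \<Rightarrow> 'a::real_vector) \<Rightarrow> bool" where
  "indep_family F x \<longleftrightarrow> (\<forall>c. (\<Sum>e\<in>F. c e *\<^sub>R x e) = 0 \<longrightarrow> (\<forall>e\<in>F. c e = 0))"

lemma indep_familyD:
  "indep_family F x \<Longrightarrow> (\<Sum>e\<in>F. c e *\<^sub>R x e) = 0 \<Longrightarrow> e \<in> F \<Longrightarrow> c e = 0"
  by (auto simp: indep_family_def)

lemma indep_family_subset:
  assumes "indep_family F x" "G \<subseteq> F" "finite F"
  shows "indep_family G x"
  unfolding indep_family_def
proof (intro allI impI ballI)
  fix c e assume c: "(\<Sum>e\<in>G. c e *\<^sub>R x e) = 0" and e: "e \<in> G"
  let ?c = "\<lambda>e. if e \<in> G then c e else 0"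
  have "(\<Sum>e\<in>F. ?c e *\<^sub>R x e) = (\<Sum>e\<in>G. c e *\<^sub>R x e)"
    using assms(2,3) by (intro sum.mono_neutral_cong_right) auto
  then show "c e = 0" using indep_familyD[OF assms(1), of ?c e] c e assms(2) by auto
qed

lemma dim_image_le_card: "finite F \<Longrightarrow> dim (x ` F) \<le> card F"
  for x :: "'e \<Rightarrow> 'a::euclidean_space"
  by (metis card_image_le dim_le_card' finite_imageI le_trans)

lemma indep_family_dim:
  fixes x :: "'e \<Rightarrow> 'a::euclidean_space"
  assumes fin: "finite F" and ind: "indep_family F x"
  shows "dim (x ` F) = card F"
proof -
  have inj: "inj_on x F"
  proof (rule inj_onI, rule ccontr)
    fix e f assume ef: "e \<in> F" "f \<in> F" "x e = x f" "e \<noteq> f"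
    let ?c = "\<lambda>g. if g = e then 1 else if g = f then -1 else (0::real)"
    have "(\<Sum>g\<in>F. ?c g *\<^sub>R x g) = (\<Sum>g\<in>{e,f}. ?c g *\<^sub>R x g)"
      using ef fin by (intro sum.mono_neutral_right) auto
    also have "\<dots> = 0" using ef by simp
    finally show False using indep_familyD[OF ind, of ?c e] ef by auto
  qed
  have "independent (x ` F)"
  proof
    assume "dependent (x ` F)"
    then obtain u where u: "(\<Sum>v\<in>x ` F. u v *\<^sub>R v) = 0" "\<exists>v\<in>x ` F. u v \<noteq> 0"
      using fin by (auto simp: dependent_finite)
    then have "(\<Sum>e\<in>F. u (x e) *\<^sub>R x e) = 0" by (simp add: sum.reindex[OF inj])
    then show False using indep_familyD[OF ind, of "\<lambda>e. u (x e)"] u(2) by auto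
  qed
  then show ?thesis by (simp add: dim_eq_card_independent card_image inj)
qed

lemma dim_imp_indep_family:
  fixes x :: "'e \<Rightarrow> 'a::euclidean_space"
  assumes fin: "finite F" and dim: "dim (x ` F) = card F"
  shows "indep_family F x"
proof (rule ccontr)
  assume "\<not> indep_family F x"
  then obtain c e where c: "(\<Sum>e\<in>F. c e *\<^sub>R x e) = 0" and e: "e \<in> F" "c e \<noteq> 0"
    by (auto simp: indep_family_def)
  have "x e = (\<Sum>f\<in>F - {e}. (- c f / c e) *\<^sub>R x f)"
  proof -
    have "c e *\<^sub>R x e = - (\<Sum>f\<in>F - {e}. c f *\<^sub>R x f)"
      using c sum.remove[OF fin e(1), of "\<lambda>f. c f *\<^sub>R x f"] by (simp add: eq_neg_iff_add_eq_0)
    then have "(1 / c e) *\<^sub>R (c e *\<^sub>R x e) = (1 / c e) *\<^sub>R (- (\<Sum>f\<in>F - {e}. c f *\<^sub>R x f))"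
      by (rule arg_cong)
    then show ?thesis using e(2) by (simp add: scaleR_sum_right sum_negf)
  qed
  moreover have "(\<Sum>f\<in>F - {e}. (- c f / c e) *\<^sub>R x f) \<in> span (x ` (F - {e}))"
    by (intro span_sum span_scale span_base) auto
  ultimately have "x e \<in> span (x ` (F - {e}))" by metis
  then have "x ` F \<subseteq> span (x ` (F - {e}))" by (auto intro: span_base)
  then have "dim (x ` F) \<le> dim (x ` (F - {e}))" by (metis dim_span dim_subset)
  also have "\<dots> \<le> card (F - {e})" using fin by (intro dim_image_le_card) auto
  also have "\<dots> < card F" using fin e(1) by (rule card_Diff1_less)
  finally show False using dim by simp
qed

text \<open>Rank and nullity: for S the rows of a rigidity matrix, the first set is the space of
  motions.\<close>

lemma dim_orthogonal_complement:
  fixes S :: "'a::euclidean_space set"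
  shows "dim {v. \<forall>s\<in>S. s \<bullet> v = 0} + dim S = DIM('a)"
proof -
  have "{v. \<forall>s\<in>S. s \<bullet> v = 0} = {v \<in> UNIV. \<forall>s\<in>span S. orthogonal s v}"
  proof (intro set_eqI iffI)
    fix v assume "v \<in> {v. \<forall>s\<in>S. s \<bullet> v = 0}"
    then have "\<forall>s\<in>S. orthogonal v s" by (auto simp: orthogonal_def inner_commute)
    then show "v \<in> {v \<in> UNIV. \<forall>s\<in>span S. orthogonal s v}"
      by (auto simp: orthogonal_commute[of _ v] intro: orthogonal_to_span)
  qed (auto simp: orthogonal_def intro: span_base)
  then show ?thesis
    using dim_subspace_orthogonal_to_vectors[of "span S" UNIV] by simp
qed

text \<open>Deleting a row that occurs in a dependence leaves the solutions unchanged, so minimality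
  forces independence. Minimal rigidity (k = 2 or k = 3) becomes independence of the rows and an
  exact number of edges.\<close>

lemma indep_family_of_minimal:
  fixes x :: "'e \<Rightarrow> 'a::euclidean_space"
  assumes fin: "finite H" and k: "dim {v. \<forall>e\<in>H. x e \<bullet> v = 0} = k"
    and min: "\<And>e. e \<in> H \<Longrightarrow> dim {v. \<forall>f\<in>H - {e}. x f \<bullet> v = 0} \<noteq> k"
  shows "indep_family H x" "card H + k = DIM('a)"
proof -
  have dims: "dim {v. \<forall>e\<in>G. x e \<bullet> v = 0} + dim (x ` G) = DIM('a)" for G
    using dim_orthogonal_complement[of "x ` G"] by simp
  show ind: "indep_family H x"
    unfolding indep_family_def
  proof (intro allI impI ballI, rule ccontr)
    fix c e assume c: "(\<Sum>e\<in>H. c e *\<^sub>R x e) = 0" and e: "e \<in> H" "c e \<noteq> 0"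
    have "x e \<bullet> v = 0" if v: "\<forall>f\<in>H - {e}. x f \<bullet> v = 0" for v
    proof -
      have "0 = (\<Sum>e\<in>H. c e *\<^sub>R x e) \<bullet> v" using c by simp
      also have "\<dots> = (\<Sum>f\<in>H. c f * (x f \<bullet> v))" by (simp add: inner_sum_left)
      also have "\<dots> = c e * (x e \<bullet> v)"
        using v fin e(1) by (subst sum.remove[of _ e]) auto
      finally show ?thesis using e(2) by simp
    qed
    then have "{v. \<forall>f\<in>H - {e}. x f \<bullet> v = 0} = {v. \<forall>e\<in>H. x e \<bullet> v = 0}" by blast
    then show False using min[OF e(1)] k by simp
  qed
  show "card H + k = DIM('a)" using dims[of H] k indep_family_dim[OF fin ind] by simp
qed

text \<open>\<open>card H\<close> equations leave at least k dimensions, so an upper bound fixes the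
  dimension; with one equation fewer at least k + 1 remain.\<close>

lemma minimal_of_card:
  fixes x :: "'e \<Rightarrow> 'a::euclidean_space"
  assumes fin: "finite H" and k: "dim {v. \<forall>e\<in>H. x e \<bullet> v = 0} \<le> k"
    and card: "card H + k = DIM('a)"
  shows "dim {v. \<forall>e\<in>H. x e \<bullet> v = 0} = k"
    "\<And>e. e \<in> H \<Longrightarrow> dim {v. \<forall>f\<in>H - {e}. x f \<bullet> v = 0} \<noteq> k"
proof -
  have dims: "dim {v. \<forall>e\<in>G. x e \<bullet> v = 0} + dim (x ` G) = DIM('a)" for G
    using dim_orthogonal_complement[of "x ` G"] by simp
  show "dim {v. \<forall>e\<in>H. x e \<bullet> v = 0} = k"
    using dims[of H] dim_image_le_card[OF fin, of x] k card by simp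
  fix e assume "e \<in> H"
  then have "card (H - {e}) < card H" using fin by (meson card_Diff1_less)
  then show "dim {v. \<forall>f\<in>H - {e}. x f \<bullet> v = 0} \<noteq> k"
    using dims[of "H - {e}"] dim_image_le_card[of "H - {e}" x] fin card by simp
qed

text \<open>Three mutually orthogonal spaces, whose dimensions add up. In use, \<open>\<tau>\<close>
  parametrises the trivial motions and J holds the unit vectors of coordinates in which all rows
  vanish.\<close>

lemma indep_family_card_bound:
  fixes x :: "'e \<Rightarrow> 'a::euclidean_space" and \<tau> :: "'b::euclidean_space \<Rightarrow> 'a"
  assumes fin: "finite F" and ind: "indep_family F x"
    and lin: "linear \<tau>" and inj: "\<And>t. \<tau> t = 0 \<Longrightarrow> t = 0"
    and J: "J \<subseteq> Basis"
    and x\<tau>: "\<And>e t. e \<in> F \<Longrightarrow> x e \<bullet> \<tau> t = 0"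
    and xJ: "\<And>e b. e \<in> F \<Longrightarrow> b \<in> J \<Longrightarrow> x e \<bullet> b = 0"
    and \<tau>J: "\<And>b t. b \<in> J \<Longrightarrow> \<tau> t \<bullet> b = 0"
  shows "card F + DIM('b) + card J \<le> DIM('a)"
proof -
  have "inj \<tau>" using lin inj by (simp add: linear_injective_0)
  then have "dim (range \<tau>) = DIM('b)" using lin by (subst dim_image_eq) auto
  moreover have "dim J = card J"
    using J by (intro dim_eq_card_independent independent_mono[OF independent_Basis])
  moreover have "dim (x ` F \<union> range \<tau>) = dim (x ` F) + dim (range \<tau>)"
    using x\<tau> by (intro dim_orthogonal_sum) auto
  moreover have "dim ((x ` F \<union> range \<tau>) \<union> J) = dim (x ` F \<union> range \<tau>) + dim J"
    using xJ \<tau>J by (intro dim_orthogonal_sum) auto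
  ultimately show ?thesis
    using indep_family_dim[OF fin ind] dim_subset_UNIV[of "(x ` F \<union> range \<tau>) \<union> J"] by simp
qed

section \<open>Generic hyperplane sections of planes\<close>

text \<open>Independence is an open condition: the map from coefficients to combinations is bounded
  below by some \<epsilon> > 0, and a change of norm at most |t| B < \<epsilon> creates no
  kernel.\<close>

lemma indep_family_perturb:
  fixes x d :: "'e::finite \<Rightarrow> 'a::euclidean_space"
  assumes "indep_family F x"
  obtains \<delta> where "\<delta> > 0" "\<And>t::real. \<bar>t\<bar> < \<delta> \<Longrightarrow> indep_family F (\<lambda>e. x e + t *\<^sub>R d e)"
proof -
  \<comment> \<open>Coefficients supported on F form a closed subspace; on all of
    \<open>real^'e\<close> the map need not be injective.\<close>
  let ?U = "{c :: real^'e. \<forall>e. e \<notin> F \<longrightarrow> c $ e = 0}"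
  let ?f = "\<lambda>y (c :: real^'e). \<Sum>e\<in>F. c $ e *\<^sub>R (y e :: 'a)"
  have U: "subspace ?U" by (auto simp: subspace_def)
  define f where "f = ?f"
  have lin: "linear (f y)" for y
  proof (rule linearI)
    show "f y (u + v) = f y u + f y v" for u v
      by (simp add: f_def scaleR_left_distrib sum.distrib)
    show "f y (r *\<^sub>R u) = r *\<^sub>R f y u" for r u
      by (simp add: f_def scaleR_sum_right)
  qed
  have inj: "\<forall>c\<in>?U. f x c = 0 \<longrightarrow> c = 0"
    using indep_familyD[OF assms] by (auto simp: vec_eq_iff f_def)
  have bl: "bounded_linear (f x)" using lin by (simp add: linear_conv_bounded_linear)
  obtain \<epsilon> where "\<epsilon> > 0" "\<forall>c\<in>?U. norm (f x c) \<ge> \<epsilon> * norm c"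
    using injective_imp_isometric[OF closed_subspace[OF U] U bl inj] by blast
  then have \<epsilon>: "\<epsilon> > 0" "\<And>c. c \<in> ?U \<Longrightarrow> norm (f x c) \<ge> \<epsilon> * norm c" by blast+
  obtain B where B: "B > 0" "\<And>c. norm (f d c) \<le> B * norm c"
    using linear_bounded_pos[OF lin] by blast
  show thesis
  proof (rule that[of "\<epsilon> / B"])
    fix t :: real assume t: "\<bar>t\<bar> < \<epsilon> / B"
    show "indep_family F (\<lambda>e. x e + t *\<^sub>R d e)"
      unfolding indep_family_def
    proof (intro allI impI ballI)
      fix c e assume c: "(\<Sum>e\<in>F. c e *\<^sub>R (x e + t *\<^sub>R d e)) = 0" and e: "e \<in> F"
      define v :: "real^'e" where "v = (\<chi> e. if e \<in> F then c e else 0)"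
      have "f x v + t *\<^sub>R f d v = (\<Sum>e\<in>F. c e *\<^sub>R (x e + t *\<^sub>R d e))"
        by (simp add: f_def v_def scaleR_sum_right scaleR_right_distrib sum.distrib mult.commute)
      then have "norm (f x v) = \<bar>t\<bar> * norm (f d v)"
        using c by (metis add_eq_0_iff norm_minus_cancel norm_scaleR)
      then have "\<epsilon> * norm v \<le> \<bar>t\<bar> * (B * norm v)"
        using \<epsilon>(2)[of v] B(2)[of v] mult_left_mono[of "norm (f d v)" "B * norm v" "\<bar>t\<bar>"]
        by (auto simp: v_def)
      moreover have "\<bar>t\<bar> * B < \<epsilon>" using t B(1) by (simp add: field_simps)
      ultimately have "v = 0"
        using mult_strict_right_mono[of "\<bar>t\<bar> * B" \<epsilon> "norm v"] by (cases "v = 0") auto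
      then show "c e = 0" using e by (simp add: v_def vec_eq_iff split: if_splits)
    qed
  qed (use \<epsilon> B in auto)
qed

text \<open>If h is not orthogonal to the plane spanned by b and c, this spans the section of that
  plane by the hyperplane normal to h. The formula is linear in h, so a variation of h can be
  differentiated term by term.\<close>

definition plane_cut :: "'a::real_inner \<Rightarrow> 'a \<Rightarrow> 'a \<Rightarrow> 'a" where
  "plane_cut b c h = (h \<bullet> c) *\<^sub>R b - (h \<bullet> b) *\<^sub>R c"

lemma plane_cut_add: "plane_cut b c (h + k) = plane_cut b c h + plane_cut b c k"
  by (simp add: plane_cut_def inner_add_left algebra_simps)

lemma plane_cut_scale: "plane_cut b c (r *\<^sub>R h) = r *\<^sub>R plane_cut b c h"
  by (simp add: plane_cut_def algebra_simps)

text \<open>The left side is the determinant of the two pairs of inner products of k and h with b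
  and c, hence alternating. A direction of variation and a test vector may thus exchange
  roles.\<close>

lemma plane_cut_skew: "k \<bullet> plane_cut b c h = - (h \<bullet> plane_cut b c k)"
  by (simp add: plane_cut_def inner_diff_right algebra_simps)

lemma plane_cut_proportional:
  assumes "k \<bullet> plane_cut b c h = 0" "h \<bullet> b \<noteq> 0 \<or> h \<bullet> c \<noteq> 0"
  obtains \<mu> where "k \<bullet> b = \<mu> * (h \<bullet> b)" "k \<bullet> c = \<mu> * (h \<bullet> c)"
proof -
  have eq: "(h \<bullet> c) * (k \<bullet> b) = (h \<bullet> b) * (k \<bullet> c)"
    using assms(1) by (simp add: plane_cut_def inner_diff_right)
  show thesis
  proof (cases "h \<bullet> b = 0")
    case True
    then show thesis using eq assms(2) by (intro that[of "(k \<bullet> c) / (h \<bullet> c)"]) auto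
  next
    case False
    then show thesis using eq by (intro that[of "(k \<bullet> b) / (h \<bullet> b)"]) (auto simp: field_simps)
  qed
qed

lemma dim_pair: "dim {b, c} \<le> 1" if "\<beta> *\<^sub>R b = \<gamma> *\<^sub>R c" "\<beta> \<noteq> 0 \<or> \<gamma> \<noteq> 0"
  for b c :: "'a::euclidean_space"
proof -
  have "\<exists>a. {b, c} \<subseteq> span {a}"
  proof (cases "\<beta> = 0")
    case True
    then have "c = 0" using that by simp
    then show ?thesis by (intro exI[of _ b]) (auto simp: span_base span_zero)
  next
    case False
    then have "b = (\<gamma> / \<beta>) *\<^sub>R c"
      using that(1) by (metis divide_inverse_commute scaleR_scaleR scaleR_one left_inverse)
    then show ?thesis by (intro exI[of _ c]) (auto simp: span_base span_scale)
  qed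
  then obtain a where "{b, c} \<subseteq> span {a}" by blast
  then have "dim {b, c} \<le> card {a}" by (intro dim_le_card) auto
  then show ?thesis by simp
qed

text \<open>A circuit of sections spans a space \<open>S\<close>; if its derivative stayed in \<open>S\<close> for every
  direction \<open>m\<close>, then modulo the hyperplane normal \<open>h\<close> every vector orthogonal to \<open>S\<close> would be
  orthogonal to all the planes, contradicting the dimension hypothesis.\<close>

lemma circuit_derivative_escapes:
  fixes b c :: "'e \<Rightarrow> 'a::euclidean_space"
  assumes fin: "finite C"
    and dims: "\<And>F. F \<subseteq> C \<Longrightarrow> F \<noteq> {} \<Longrightarrow> card F + 1 \<le> dim (b ` F \<union> c ` F)"
    and sub: "\<And>e. e \<in> C \<Longrightarrow> indep_family (C - {e}) (\<lambda>e. plane_cut (b e) (c e) h)"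
    and l0: "(\<Sum>e\<in>C. l e *\<^sub>R plane_cut (b e) (c e) h) = 0" and ne: "C \<noteq> {}"
    and l: "\<And>e. e \<in> C \<Longrightarrow> l e \<noteq> 0"
  obtains m where "(\<Sum>e\<in>C. l e *\<^sub>R plane_cut (b e) (c e) m) \<notin> span ((\<lambda>e. plane_cut (b e) (c e) h) ` C)"
proof (rule ccontr)
  define x where "x h e = plane_cut (b e) (c e) h" for h e
  let ?S = "x h ` C"
  assume "\<not> thesis"
  with that have inS: "(\<Sum>e\<in>C. l e *\<^sub>R x m e) \<in> span ?S" for m
    unfolding x_def by blast
  have dim_pair2: "dim {b e, c e} \<ge> 2" if "e \<in> C" for e
    using dims[of "{e}"] that by (simp add: insert_commute)
  have xn: "x k e \<noteq> 0" if "e \<in> C" "k \<bullet> b e \<noteq> 0 \<or> k \<bullet> c e \<noteq> 0" for k e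
  proof
    assume "x k e = 0"
    then have "(k \<bullet> c e) *\<^sub>R b e = (k \<bullet> b e) *\<^sub>R c e" by (simp add: x_def plane_cut_def)
    then show False using dim_pair[of "k \<bullet> c e" "b e" "k \<bullet> b e" "c e"] that dim_pair2[OF that(1)] by auto
  qed
  \<comment> \<open>Since \<phi> is orthogonal to S, \<open>inS\<close> and skewness make
    \<open>?w\<close> orthogonal to every direction m, in particular to itself.\<close>
  have zero: "(\<Sum>e\<in>C. l e *\<^sub>R x \<phi> e) = 0" if \<phi>: "\<And>s. s \<in> ?S \<Longrightarrow> \<phi> \<bullet> s = 0" for \<phi>
  proof -
    let ?w = "\<Sum>e\<in>C. l e *\<^sub>R x \<phi> e"
    have "orthogonal \<phi> s" if "s \<in> span ?S" for s
      using that by (rule orthogonal_to_span) (use \<phi> in \<open>simp add: orthogonal_def\<close>)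
    then have "\<phi> \<bullet> (\<Sum>e\<in>C. l e *\<^sub>R x ?w e) = 0" using inS by (auto simp: orthogonal_def)
    moreover have "\<phi> \<bullet> (\<Sum>e\<in>C. l e *\<^sub>R x ?w e) = - (?w \<bullet> ?w)"
    proof -
      have "\<phi> \<bullet> (\<Sum>e\<in>C. l e *\<^sub>R x k e) = - (k \<bullet> (\<Sum>e\<in>C. l e *\<^sub>R x \<phi> e))" for k
        unfolding x_def inner_sum_right inner_scaleR_right
        by (subst plane_cut_skew) (simp add: sum_negf)
      then show ?thesis .
    qed
    ultimately show ?thesis by simp
  qed
  \<comment> \<open>Otherwise the section of e is 0 and the circuit is e alone; then
    \<open>zero\<close> applies to \<open>b e\<close> and \<open>c e\<close>, which contradicts the
    dimension 2 of the plane of e.\<close>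
  have h_nz: "h \<bullet> b e \<noteq> 0 \<or> h \<bullet> c e \<noteq> 0" if e: "e \<in> C" for e
  proof (rule ccontr)
    assume "\<not> ?thesis"
    then have x0: "x h e = 0" by (simp add: x_def plane_cut_def)
    have "C = {e}"
    proof (rule ccontr)
      assume "C \<noteq> {e}"
      then obtain f where f: "f \<in> C" "f \<noteq> e" using e by blast
      have "(\<Sum>g\<in>C - {f}. (if g = e then 1 else 0::real) *\<^sub>R x h g) = 0"
        using x0 by (intro sum.neutral) auto
      from indep_familyD[OF sub[OF f(1)] this[unfolded x_def], of e] e f show False by simp
    qed
    then have "x (b e) e = 0" "x (c e) e = 0"
      using zero[of "b e"] zero[of "c e"] x0 l[OF e] by auto
    then have "b e \<bullet> b e = 0" "c e \<bullet> c e = 0" using xn[OF e, of "b e"] xn[OF e, of "c e"] by auto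
    then show False using dim_pair2[OF e] by simp
  qed
  obtain e0 where e0: "e0 \<in> C" using ne by blast
  \<comment> \<open>On the plane of each e, \<phi> is a multiple \<open>\<mu> e\<close> of h. The
    relation of a circuit is unique up to scaling, so \<mu> is constant, and \<phi> minus that
    multiple of h is orthogonal to all the planes.\<close>
  have sub_span: "\<phi> \<in> span (insert h {v. \<forall>w\<in>b ` C \<union> c ` C. w \<bullet> v = 0})"
    if \<phi>: "\<forall>s\<in>?S. s \<bullet> \<phi> = 0" for \<phi>
  proof -
    have "\<exists>\<mu>. \<phi> \<bullet> b e = \<mu> * (h \<bullet> b e) \<and> \<phi> \<bullet> c e = \<mu> * (h \<bullet> c e)" if "e \<in> C" for e
    proof -
      have "\<phi> \<bullet> plane_cut (b e) (c e) h = 0" using \<phi> that by (auto simp: x_def inner_commute)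
      then show ?thesis using plane_cut_proportional h_nz[OF that] by metis
    qed
    then obtain \<mu> where \<mu>: "\<And>e. e \<in> C \<Longrightarrow> \<phi> \<bullet> b e = \<mu> e * (h \<bullet> b e)"
      "\<And>e. e \<in> C \<Longrightarrow> \<phi> \<bullet> c e = \<mu> e * (h \<bullet> c e)" by metis
    have x\<phi>: "x \<phi> e = \<mu> e *\<^sub>R x h e" if "e \<in> C" for e
      using \<mu>[OF that] by (simp add: x_def plane_cut_def algebra_simps)
    have "(\<Sum>e\<in>C. (l e * \<mu> e) *\<^sub>R x h e) = 0"
      using zero[of \<phi>] \<phi> x\<phi> by (simp add: inner_commute)
    moreover have "(\<Sum>e\<in>C. (l e * \<mu> e0) *\<^sub>R x h e) = \<mu> e0 *\<^sub>R (\<Sum>e\<in>C. l e *\<^sub>R x h e)"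
      by (simp add: scaleR_sum_right mult.commute)
    ultimately have "(\<Sum>e\<in>C. (l e * (\<mu> e - \<mu> e0)) *\<^sub>R x h e) = 0"
      using l0 by (simp add: right_diff_distrib scaleR_left_diff_distrib sum_subtractf x_def)
    then have "(\<Sum>e\<in>C - {e0}. (l e * (\<mu> e - \<mu> e0)) *\<^sub>R x h e) = 0"
      using e0 fin by (simp add: sum.remove)
    then have "l e * (\<mu> e - \<mu> e0) = 0" if "e \<in> C - {e0}" for e
      using indep_familyD[OF sub[OF e0] _ that, of "\<lambda>e. l e * (\<mu> e - \<mu> e0)"]
      unfolding x_def by simp
    then have const: "\<mu> e = \<mu> e0" if "e \<in> C" for e using l that by (cases "e = e0") auto
    have "\<phi> - \<mu> e0 *\<^sub>R h \<in> {v. \<forall>w\<in>b ` C \<union> c ` C. w \<bullet> v = 0}"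
      using \<mu> const by (auto simp: inner_diff_right inner_commute)
    then have "(\<phi> - \<mu> e0 *\<^sub>R h) + \<mu> e0 *\<^sub>R h \<in> span (insert h {v. \<forall>w\<in>b ` C \<union> c ` C. w \<bullet> v = 0})"
      by (intro span_add span_scale) (auto intro: span_base)
    then show ?thesis by simp
  qed
  \<comment> \<open>Passing to complements, S has at most one dimension less than the span of the
    planes, hence at least \<open>card C\<close>; but the sections are dependent.\<close>
  have "dim {v. \<forall>s\<in>?S. s \<bullet> v = 0} \<le> dim (insert h {v. \<forall>w\<in>b ` C \<union> c ` C. w \<bullet> v = 0})"
    using sub_span by (intro dim_mono) auto
  also have "\<dots> \<le> dim {v. \<forall>w\<in>b ` C \<union> c ` C. w \<bullet> v = 0} + 1"
    by (simp add: dim_insert)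
  finally have "dim {v. \<forall>s\<in>?S. s \<bullet> v = 0} \<le> dim {v. \<forall>w\<in>b ` C \<union> c ` C. w \<bullet> v = 0} + 1" .
  moreover have "dim ?S < card C"
  proof -
    have "dim ?S \<noteq> card C"
      using dim_imp_indep_family[OF fin, of "x h"] l0 l e0 indep_familyD[of C "x h" l e0]
      by (auto simp: x_def)
    then show ?thesis using dim_image_le_card[OF fin, of "x h"] by simp
  qed
  ultimately show False
    using dim_orthogonal_complement[of ?S] dim_orthogonal_complement[of "b ` C \<union> c ` C"]
      dims[OF order_refl ne] by linarith
qed

text \<open>The relation l, applied to the moved sections, gives t v with v outside the span of the
  old ones. So v can replace one section: the exchanged family is independent at t = 0, by openness
  also for small t, and for t > 0 the exchange can be undone.\<close>

lemma circuit_becomes_independent: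
  fixes b c :: "'e::finite \<Rightarrow> 'a::euclidean_space"
  assumes dims: "\<And>F. F \<subseteq> C \<Longrightarrow> F \<noteq> {} \<Longrightarrow> card F + 1 \<le> dim (b ` F \<union> c ` F)"
    and dep: "\<not> indep_family C (\<lambda>e. plane_cut (b e) (c e) h)"
    and sub: "\<And>e. e \<in> C \<Longrightarrow> indep_family (C - {e}) (\<lambda>e. plane_cut (b e) (c e) h)"
  obtains m \<delta> where "\<delta> > 0"
    "\<And>t. 0 < t \<Longrightarrow> t < \<delta> \<Longrightarrow> indep_family C (\<lambda>e. plane_cut (b e) (c e) (h + t *\<^sub>R m))"
proof -
  define x where "x h e = plane_cut (b e) (c e) h" for h e
  have xlin: "x (h + t *\<^sub>R m) e = x h e + t *\<^sub>R x m e" for h t m e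
    by (simp add: x_def plane_cut_add plane_cut_scale)
  obtain l e0 where l0: "(\<Sum>e\<in>C. l e *\<^sub>R x h e) = 0" and e0: "e0 \<in> C" "l e0 \<noteq> 0"
    using dep by (auto simp: indep_family_def x_def)
  have l: "l e \<noteq> 0" if "e \<in> C" for e
  proof
    assume "l e = 0"
    then have "(\<Sum>e\<in>C - {e}. l e *\<^sub>R x h e) = 0" using l0 that by (simp add: sum.remove)
    then show False
      using indep_familyD[OF sub[OF that], of l e0] e0 \<open>l e = 0\<close> by (auto simp: x_def)
  qed
  obtain m where m: "(\<Sum>e\<in>C. l e *\<^sub>R x m e) \<notin> span (x h ` C)"
    using circuit_derivative_escapes[of C b c h l] dims sub l0 e0 l unfolding x_def by auto
  define v where "v = (\<Sum>e\<in>C. l e *\<^sub>R x m e)"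
  let ?y = "\<lambda>e. if e = e0 then v else x h e"
  \<comment> \<open>No variation at e0: the combination with coefficients l, divided by t, equals v
    for every t > 0.\<close>
  let ?d = "\<lambda>e. if e = e0 then 0 else x m e"
  have "indep_family C ?y"
    unfolding indep_family_def
  proof (intro allI impI)
    fix a assume a: "(\<Sum>e\<in>C. a e *\<^sub>R ?y e) = 0"
    have rest: "(\<Sum>e\<in>C - {e0}. a e *\<^sub>R ?y e) = (\<Sum>e\<in>C - {e0}. a e *\<^sub>R x h e)"
      by (intro sum.cong) auto
    then have eq: "a e0 *\<^sub>R v + (\<Sum>e\<in>C - {e0}. a e *\<^sub>R x h e) = 0"
      using a e0(1) by (simp add: sum.remove)
    have "(\<Sum>e\<in>C - {e0}. a e *\<^sub>R x h e) \<in> span (x h ` C)"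
      by (intro span_sum span_scale span_base) auto
    moreover have "a e0 *\<^sub>R v = - (\<Sum>e\<in>C - {e0}. a e *\<^sub>R x h e)"
      using eq by (simp add: eq_neg_iff_add_eq_0)
    ultimately have av: "a e0 *\<^sub>R v \<in> span (x h ` C)" using span_neg by metis
    have "a e0 = 0"
    proof (rule ccontr)
      assume "a e0 \<noteq> 0"
      then have "v = (1 / a e0) *\<^sub>R (a e0 *\<^sub>R v)" by simp
      also have "\<dots> \<in> span (x h ` C)" using av by (rule span_scale)
      finally show False using m unfolding v_def by contradiction
    qed
    moreover have "a e = 0" if "e \<in> C - {e0}" for e
      using indep_familyD[OF sub[OF e0(1)] _ that, of a] eq \<open>a e0 = 0\<close> by (simp add: x_def)
    ultimately show "\<forall>e\<in>C. a e = 0" by blast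
  qed
  from indep_family_perturb[OF this, of ?d]
  obtain \<delta> where \<delta>: "\<delta> > 0" "\<And>t::real. \<bar>t\<bar> < \<delta> \<Longrightarrow> indep_family C (\<lambda>e. ?y e + t *\<^sub>R ?d e)"
    by blast
  have "indep_family C (x (h + t *\<^sub>R m))" if t: "0 < t" "t < \<delta>" for t
    unfolding indep_family_def
  proof (intro allI impI)
    fix a assume a: "(\<Sum>e\<in>C. a e *\<^sub>R x (h + t *\<^sub>R m) e) = 0"
    let ?z = "x (h + t *\<^sub>R m)"
    \<comment> \<open>Subtracting r times the combination l removes the coefficient at e0;
      \<open>?a\<close> rewrites the relation a in the exchanged family.\<close>
    define r where "r = a e0 / l e0"
    have tv: "(\<Sum>e\<in>C. l e *\<^sub>R ?z e) = t *\<^sub>R v"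
      using l0 by (simp add: xlin scaleR_right_distrib sum.distrib v_def scaleR_sum_right mult.commute)
    let ?a = "\<lambda>e. if e = e0 then r * t else a e - r * l e"
    have "(\<Sum>e\<in>C. ?a e *\<^sub>R (?y e + t *\<^sub>R ?d e)) = (r * t) *\<^sub>R v + (\<Sum>e\<in>C - {e0}. (a e - r * l e) *\<^sub>R ?z e)"
      using e0(1) by (simp add: sum.remove xlin)
    also have "(\<Sum>e\<in>C - {e0}. (a e - r * l e) *\<^sub>R ?z e) = (\<Sum>e\<in>C. (a e - r * l e) *\<^sub>R ?z e)"
      using e0 by (simp add: sum.remove r_def)
    also have "\<dots> = - (r *\<^sub>R (t *\<^sub>R v))"
      unfolding tv[symmetric] scaleR_left_diff_distrib sum_subtractf a
      by (simp add: scaleR_sum_right)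
    finally have "(\<Sum>e\<in>C. ?a e *\<^sub>R (?y e + t *\<^sub>R ?d e)) = 0" by simp
    from indep_familyD[OF \<delta>(2) this] t have all: "?a e = 0" if "e \<in> C" for e
      using that by auto
    then have "r = 0" using all[OF e0(1)] t by simp
    then have "a e = 0" if "e \<in> C" for e
      using all[OF that] e0 by (cases "e = e0") (auto simp: r_def)
    then show "\<forall>e\<in>C. a e = 0" by blast
  qed
  then show thesis using that \<delta>(1) unfolding x_def by blast
qed

text \<open>The normal \<open>h\<close> is chosen to maximise the number of independent subfamilies plus the number
  of nonzero \<open>h \<bullet> d\<close>; these properties survive small perturbations, so at a maximum neither a
  circuit nor a zero \<open>h \<bullet> d\<close> can remain.\<close>

theorem generic_plane_cut_independent:
  fixes b c :: "'e::finite \<Rightarrow> 'a::euclidean_space"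
  assumes dims: "\<And>F. F \<subseteq> E \<Longrightarrow> F \<noteq> {} \<Longrightarrow> card F + 1 \<le> dim (b ` F \<union> c ` F)"
    and D: "finite D" "0 \<notin> D"
  shows "\<exists>h. indep_family E (\<lambda>e. plane_cut (b e) (c e) h) \<and> (\<forall>d\<in>D. h \<bullet> d \<noteq> 0)"
proof -
  define x where "x h e = plane_cut (b e) (c e) h" for h e
  have xlin: "x (h + t *\<^sub>R m) e = x h e + t *\<^sub>R x m e" for h t m e
    by (simp add: x_def plane_cut_add plane_cut_scale)
  define I where "I h = {F. F \<subseteq> E \<and> indep_family F (x h)}" for h
  define N where "N h = {d \<in> D. h \<bullet> d \<noteq> 0}" for h
  define w where "w h = card (I h) + card (N h)" for h
  have fI: "finite (I h)" for h by simp
  have fN: "finite (N h)" for h using D by (simp add: N_def)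
  have "w h \<le> card (Pow E) + card D" for h
    unfolding w_def I_def N_def using D by (intro add_mono card_mono) auto
  then obtain h where h: "\<And>k. w k \<le> w h"
    using ex_has_greatest_nat[of "\<lambda>_. True" undefined w] by (metis less_Suc_eq_le)
  have stable: "\<exists>\<delta>>0. \<forall>t. 0 < t \<and> t < \<delta> \<longrightarrow> I h \<subseteq> I (h + t *\<^sub>R m) \<and> N h \<subseteq> N (h + t *\<^sub>R m)" for m
  proof -
    have "\<forall>\<^sub>F t in at_right (0::real). indep_family F (x (h + t *\<^sub>R m))" if F: "F \<in> I h" for F
    proof -
      obtain \<delta> where "\<delta> > 0" "\<And>t. \<bar>t\<bar> < \<delta> \<Longrightarrow> indep_family F (\<lambda>e. x h e + t *\<^sub>R x m e)"
        using indep_family_perturb[of F "x h" "x m"] F unfolding I_def by blast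
      then show ?thesis unfolding eventually_at_right_field xlin[abs_def]
        by (intro exI[of _ \<delta>]) auto
    qed
    then have 1: "\<forall>\<^sub>F t in at_right (0::real). \<forall>F\<in>I h. indep_family F (x (h + t *\<^sub>R m))"
      using fI by (intro eventually_ball_finite) auto
    have "\<forall>\<^sub>F t in at_right (0::real). (h + t *\<^sub>R m) \<bullet> d \<noteq> 0" if "d \<in> N h" for d
    proof -
      have "((\<lambda>t. (h + t *\<^sub>R m) \<bullet> d) \<longlongrightarrow> (h + 0 *\<^sub>R m) \<bullet> d) (at_right (0::real))"
        by (intro tendsto_intros)
      then show ?thesis using that by (intro tendsto_imp_eventually_ne) (auto simp: N_def)
    qed
    then have 2: "\<forall>\<^sub>F t in at_right (0::real). \<forall>d\<in>N h. (h + t *\<^sub>R m) \<bullet> d \<noteq> 0"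
      using fN by (intro eventually_ball_finite) auto
    from eventually_conj[OF 1 2] show ?thesis
      unfolding eventually_at_right_field by (auto simp: I_def N_def)
  qed
  have max: False if "\<delta> > 0" "\<And>t. 0 < t \<Longrightarrow> t < \<delta> \<Longrightarrow>
      I (h + t *\<^sub>R m) - I h \<noteq> {} \<or> N (h + t *\<^sub>R m) - N h \<noteq> {}" for \<delta> m
  proof -
    obtain \<delta>' where \<delta>': "\<delta>' > 0"
      "\<And>t. 0 < t \<Longrightarrow> t < \<delta>' \<Longrightarrow> I h \<subseteq> I (h + t *\<^sub>R m) \<and> N h \<subseteq> N (h + t *\<^sub>R m)"
      using stable[of m] by blast
    define t where "t = min \<delta> \<delta>' / 2"
    have t: "0 < t" "t < \<delta>" "t < \<delta>'" using that(1) \<delta>'(1) by (auto simp: t_def)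
    have s: "I h \<subseteq> I (h + t *\<^sub>R m)" "N h \<subseteq> N (h + t *\<^sub>R m)" using \<delta>'(2) t by auto
    have le: "card (I h) \<le> card (I (h + t *\<^sub>R m))" "card (N h) \<le> card (N (h + t *\<^sub>R m))"
      using s fI fN by (auto intro: card_mono)
    from that(2)[OF t(1,2)] have "card (I h) < card (I (h + t *\<^sub>R m)) \<or> card (N h) < card (N (h + t *\<^sub>R m))"
      using s fI fN by (metis Diff_eq_empty_iff psubsetI psubset_card_mono)
    then show False using h[of "h + t *\<^sub>R m"] le by (auto simp: w_def)
  qed
  show ?thesis
  proof (intro exI[of _ h] conjI ballI)
    show "indep_family E (\<lambda>e. plane_cut (b e) (c e) h)"
    proof (rule ccontr)
      assume "\<not> ?thesis"
      then have ne: "{F. F \<subseteq> E \<and> \<not> indep_family F (x h)} \<noteq> {}" by (auto simp: x_def[abs_def])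
      have "finite {F. F \<subseteq> E \<and> \<not> indep_family F (x h)}" by simp
      from finite_has_minimal[OF this ne] obtain C where C: "C \<in> {F. F \<subseteq> E \<and> \<not> indep_family F (x h)}"
        and min: "\<forall>F\<in>{F. F \<subseteq> E \<and> \<not> indep_family F (x h)}. F \<subseteq> C \<longrightarrow> C = F"
        by blast
      have Cmin: "indep_family (C - {e}) (x h)" if "e \<in> C" for e
      proof (rule ccontr)
        assume "\<not> ?thesis"
        then have "C = C - {e}" using C by (intro min[rule_format]) auto
        then show False using that by blast
      qed
      have dep: "\<not> indep_family C (\<lambda>e. plane_cut (b e) (c e) h)"
        using C by (simp add: x_def[abs_def])
      have dimsC: "card F + 1 \<le> dim (b ` F \<union> c ` F)" if "F \<subseteq> C" "F \<noteq> {}" for F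
        using that C by (intro dims) auto
      obtain m \<delta> where "\<delta> > 0" "\<And>t. 0 < t \<Longrightarrow> t < \<delta> \<Longrightarrow> indep_family C (x (h + t *\<^sub>R m))"
        using circuit_becomes_independent[OF dimsC dep Cmin[unfolded x_def[abs_def]]]
        unfolding x_def[abs_def] by blast
      then show False using C by (intro max[of \<delta> m]) (auto simp: I_def)
    qed
    fix d assume d: "d \<in> D"
    show "h \<bullet> d \<noteq> 0"
    proof
      assume "h \<bullet> d = 0"
      \<comment> \<open>Moving h towards d itself produces the inner product t (d . d), which is
        positive.\<close>
      then have "d \<in> N (h + t *\<^sub>R d) - N h" if "0 < t" for t
        using that d D(2) by (auto simp: N_def inner_add_left)
      then show False by (intro max[of 1 d]) auto
    qed
  qed
qed

section \<open>Bar-joint frameworks\<close>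

lemma indep_family_linear_image:
  assumes "linear f" "\<And>v. f v = 0 \<Longrightarrow> v = 0" "indep_family F x"
  shows "indep_family F (\<lambda>e. f (x e))"
  unfolding indep_family_def
proof (intro allI impI)
  fix c assume "(\<Sum>e\<in>F. c e *\<^sub>R f (x e)) = 0"
  then have "f (\<Sum>e\<in>F. c e *\<^sub>R x e) = 0" by (simp add: assms(1) linear_sum linear_scale)
  then show "\<forall>e\<in>F. c e = 0" using assms(2,3) by (auto simp: indep_family_def)
qed

lemma indep_family_linear_preimage:
  assumes "linear f" "indep_family F (\<lambda>e. f (x e))"
  shows "indep_family F x"
  unfolding indep_family_def
proof (intro allI impI)
  fix c assume "(\<Sum>e\<in>F. c e *\<^sub>R x e) = 0"
  then have "f (\<Sum>e\<in>F. c e *\<^sub>R x e) = 0" by (simp add: assms(1) linear_0)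
  then have "(\<Sum>e\<in>F. c e *\<^sub>R f (x e)) = 0" by (simp add: assms(1) linear_sum linear_scale)
  then show "\<forall>e\<in>F. c e = 0" using assms(2) by (auto simp: indep_family_def)
qed

lemma indep_family_nonzero:
  assumes "indep_family F x" "e \<in> F" "finite F"
  shows "x e \<noteq> 0"
proof
  assume "x e = 0"
  then have "(\<Sum>f\<in>F. (if f = e then 1 else 0) *\<^sub>R x f) = 0" by (intro sum.neutral) auto
  from indep_familyD[OF assms(1) this assms(2)] show False by simp
qed

text \<open>Edges are sets, so an orientation is fixed by choice. Reversing it leaves
  \<open>bar_row\<close> and \<open>fixed_normal_row\<close> unchanged and negates
  \<open>edge_vec\<close>.\<close>

definition tail :: "'v set \<Rightarrow> 'v" where
  "tail e = fst (SOME uv. e = {fst uv, snd uv})"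

definition head :: "'v set \<Rightarrow> 'v" where
  "head e = snd (SOME uv. e = {fst uv, snd uv})"

lemma edge_ends:
  assumes "card e = 2"
  shows "e = {tail e, head e}" "tail e \<noteq> head e"
proof -
  obtain u v where "e = {u, v}" "u \<noteq> v" using assms by (auto simp: card_2_iff)
  then have "\<exists>uv. e = {fst uv, snd uv}" by (intro exI[of _ "(u, v)"]) simp
  from someI_ex[OF this] show e: "e = {tail e, head e}" unfolding tail_def head_def .
  show "tail e \<noteq> head e"
  proof
    assume "tail e = head e"
    then have "e = {head e}" using e by simp
    then show False using assms by (metis card_1_singleton_iff card.insert One_nat_def is_singletonI is_singleton_altdef numeral_eq_one_iff semiring_norm(85))
  qed
qed

lemma edge_endsE:
  assumes "card e = 2" "e = {u, v}"
  obtains "tail e = u" "head e = v" | "tail e = v" "head e = u"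
  using edge_ends[OF assms(1)] assms(2) by (metis doubleton_eq_iff)

section \<open>Rows of the bar-joint rigidity matrix\<close>

definition bar_row :: "('v \<Rightarrow> real^2) \<Rightarrow> 'v set \<Rightarrow> (real^2)^'v" where
  "bar_row q e = axis (tail e) (q (tail e) - q (head e)) - axis (head e) (q (tail e) - q (head e))"

lemma bar_row_inner:
  "bar_row q e \<bullet> v = (q (tail e) - q (head e)) \<bullet> (v $ tail e - v $ head e)"
  by (simp add: bar_row_def inner_diff_left inner_axis' inner_diff_right)

lemma bar_joint_motions_eq:
  fixes q :: "'v::finite \<Rightarrow> real^2"
  assumes "simple_graph UNIV H"
  shows "bar_joint_motions H q = {v. \<forall>e\<in>H. bar_row q e \<bullet> v = 0}"
proof (intro set_eqI iffI)
  fix v assume "v \<in> bar_joint_motions H q"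
  then have v: "(q i - q j) \<bullet> (v $ i - v $ j) = 0" if "{i, j} \<in> H" for i j
    using that by (auto simp: bar_joint_motions_def)
  have "bar_row q e \<bullet> v = 0" if "e \<in> H" for e
    using assms that edge_ends(1)[of e] v[of "tail e" "head e"]
    by (auto simp: simple_graph_def bar_row_inner)
  then show "v \<in> {v. \<forall>e\<in>H. bar_row q e \<bullet> v = 0}" by blast
next
  fix v assume v: "v \<in> {v. \<forall>e\<in>H. bar_row q e \<bullet> v = 0}"
  have "(q i - q j) \<bullet> (v $ i - v $ j) = 0" if e: "{i, j} \<in> H" for i j
  proof -
    have c: "card {i, j} = 2" using assms e by (auto simp: simple_graph_def)
    have "(q (tail {i, j}) - q (head {i, j})) \<bullet> (v $ tail {i, j} - v $ head {i, j}) = 0"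
      using v e by (auto simp: bar_row_inner)
    with c show ?thesis
      by (cases rule: edge_endsE[OF c refl]) (auto simp: inner_diff_left inner_diff_right)
  qed
  then show "v \<in> bar_joint_motions H q" by (auto simp: bar_joint_motions_def)
qed

section \<open>The quarter turn and coordinates of velocities\<close>

definition perp :: "real^2 \<Rightarrow> real^2" where
  "perp x = (\<chi> k. if k = 1 then - x $ 2 else x $ 1)"

lemma perp_nth [simp]: "perp x $ 1 = - x $ 2" "perp x $ 2 = x $ 1"
  by (simp_all add: perp_def)

lemma inner_2: "x \<bullet> y = x $ 1 * y $ 1 + x $ 2 * y $ 2" for x y :: "real^2"
  by (simp add: inner_vec_def sum_2)

lemma vec_eq_2: "x = y \<longleftrightarrow> x $ 1 = y $ 1 \<and> x $ 2 = y $ 2" for x y :: "real^2"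
  by (simp add: vec_eq_iff forall_2)

lemma vec_eqI: "(\<And>u. x $ u = y $ u) \<Longrightarrow> x = y"
  by (simp add: vec_eq_iff)

lemma axis2_in_Basis: "axis u (axis k 1) \<in> (Basis :: ((real^2)^'v) set)"
  by (simp add: axis_in_Basis_iff)

lemma inj_axis2: "inj (\<lambda>(u, k). axis u (axis k 1) :: (real^2)^'v)"
  by (auto simp: inj_def axis_eq_axis)

text \<open>Used twice: with W the covered vertices it counts the coordinates that no row sees, with
  W their complement those that the edge planes see.\<close>

lemma card_constrained_coordinates:
  fixes W L :: "'v::finite set"
  shows "card {(u, k :: 2). u \<notin> W \<and> (u \<in> L \<longrightarrow> k = 2)} = 2 * card (- W - L) + card (L - W)"
proof -
  have "{(u, k :: 2). u \<notin> W \<and> (u \<in> L \<longrightarrow> k = 2)} = (- W - L) \<times> UNIV \<union> (L - W) \<times> {2}" by auto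
  also have "card \<dots> = card ((- W - L) \<times> (UNIV :: 2 set)) + card ((L - W) \<times> {2 :: 2})"
    by (intro card_Un_disjoint) auto
  finally show ?thesis by (simp add: card_cartesian_product)
qed

lemma axis_row_orthogonal:
  "bar_row q e \<bullet> axis u b = 0" if "u \<noteq> tail e" "u \<noteq> head e" for u
  using that by (simp add: bar_row_inner axis_def)

text \<open>The motions \<open>\<tau> (a, \<gamma>)\<close> are the trivial ones, restricted to the vertices of \<open>F\<close> except that
  the velocities of the points of \<open>L\<close> keep their component along the common line.\<close>

lemma bar_joint_count:
  fixes q :: "'v::finite \<Rightarrow> real^2"
  assumes ind: "indep_family (F \<union> T) (bar_row q)" and ne: "F \<noteq> {}"
    and F: "simple_graph UNIV F" and T: "simple_graph L T" and q: "\<And>u. u \<in> L \<Longrightarrow> q u $ 2 = 0"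
  shows "card (F \<union> T) + 3 \<le> 2 * card (\<Union>F - L) + card (L \<inter> \<Union>F) + card L"
proof -
  let ?W = "\<Union>F"
  define \<tau> :: "(real^2) \<times> real \<Rightarrow> (real^2)^'v" where
    "\<tau> = (\<lambda>(a, \<gamma>). \<chi> u. if u \<in> ?W then a + \<gamma> *\<^sub>R perp (q u)
       else if u \<in> L then axis 1 (a $ 1) else 0)"
  \<comment> \<open>The bars of T lie along the first axis, so at uncovered points of L only the
    second component is invisible to all rows.\<close>
  define J where "J = (\<lambda>(u, k). axis u (axis k 1) :: (real^2)^'v) `
    {(u, k :: 2). u \<notin> ?W \<and> (u \<in> L \<longrightarrow> k = 2)}"
  have ends: "tail e \<in> e" "head e \<in> e" "card e = 2" if "e \<in> F \<union> T" for e
    using edge_ends(1)[of e] F T that by (auto simp: simple_graph_def)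
  have Tends: "tail e \<in> L" "head e \<in> L" if "e \<in> T" for e
    using ends[of e] T that by (auto simp: simple_graph_def)
  \<comment> \<open>A rotation moves points of the first axis vertically. So all of L has the same
    tangential velocity under \<open>\<tau>\<close>, covered by F or not, and no bar of T is
    strained.\<close>
  have comp1: "\<tau> (a, \<gamma>) $ u $ 1 = a $ 1" if "u \<in> L" for a \<gamma> u
    using q[OF that] that by (simp add: \<tau>_def)
  have "card (F \<union> T) + DIM((real^2) \<times> real) + card J \<le> DIM((real^2)^'v)"
  proof (rule indep_family_card_bound[OF _ ind, where \<tau> = \<tau>])
    show "linear \<tau>"
    proof (rule linearI)
      show "\<tau> (s + t) = \<tau> s + \<tau> t" for s t
        by (cases s; cases t; rule vec_eqI)
          (simp add: \<tau>_def vec_eq_2 axis_def algebra_simps)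
      show "\<tau> (r *\<^sub>R t) = r *\<^sub>R \<tau> t" for r t
        by (cases t; rule vec_eqI) (simp add: \<tau>_def vec_eq_2 axis_def algebra_simps)
    qed
    show "t = 0" if t: "\<tau> t = 0" for t
    proof -
      obtain a \<gamma> where [simp]: "t = (a, \<gamma>)" by (cases t)
      obtain e where e: "e \<in> F" using ne by blast
      have W: "tail e \<in> ?W" "head e \<in> ?W" using ends[of e] e by auto
      have at: "a + \<gamma> *\<^sub>R perp (q u) = 0" if "u \<in> ?W" for u
      proof -
        have "\<tau> t $ u = 0" using t by simp
        then show ?thesis using that by (simp add: \<tau>_def)
      qed
      have "\<gamma> *\<^sub>R perp (q (tail e)) = \<gamma> *\<^sub>R perp (q (head e))"
        using at[OF W(1)] at[OF W(2)] by (metis add_left_cancel)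
      moreover have "q (tail e) \<noteq> q (head e)"
        using indep_family_nonzero[OF ind, of e] e by (auto simp: bar_row_def axis_eq_0_iff[THEN iffD2])
      ultimately have "\<gamma> = 0" by (auto simp: vec_eq_2)
      then show ?thesis using at[OF W(1)] by (simp add: zero_prod_def)
    qed
    show "J \<subseteq> Basis" by (auto simp: J_def axis2_in_Basis)
    show "bar_row q e \<bullet> \<tau> t = 0" if e: "e \<in> F \<union> T" for e t
    proof (cases "e \<in> F")
      case True
      then have "tail e \<in> ?W" "head e \<in> ?W" using ends[of e] by auto
      then show ?thesis
        by (cases t) (simp add: bar_row_inner \<tau>_def inner_2, simp add: algebra_simps)
    next
      case False
      then have "tail e \<in> L" "head e \<in> L" using Tends e by auto
      then show ?thesis
        using comp1 q by (cases t) (simp add: bar_row_inner inner_2)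
    qed
    show "bar_row q e \<bullet> b = 0" if e: "e \<in> F \<union> T" and b: "b \<in> J" for e b
    proof -
      obtain u k where u: "b = axis u (axis k 1)" "u \<notin> ?W" "u \<in> L \<Longrightarrow> k = 2"
        using b by (auto simp: J_def)
      show ?thesis
      proof (cases "u = tail e \<or> u = head e")
        case True
        then have "e \<in> T" using ends[of e] e u(2) by auto
        then have "tail e \<in> L" "head e \<in> L" "k = 2" using Tends True u(3) by auto
        then show ?thesis using q u(1) by (simp add: bar_row_inner inner_2 axis_def)
      next
        case False
        then show ?thesis using axis_row_orthogonal[of u e q] u(1) by simp
      qed
    qed
    show "\<tau> t \<bullet> b = 0" if b: "b \<in> J" for b t
    proof -
      obtain u k where u: "b = axis u (axis k 1)" "u \<notin> ?W" "u \<in> L \<Longrightarrow> k = 2"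
        using b by (auto simp: J_def)
      have "\<tau> t $ u $ k = 0"
        using u(2,3) by (cases t; cases "u \<in> L") (simp_all add: \<tau>_def axis_def)
      then show ?thesis by (simp add: u(1) inner_axis)
    qed
  qed simp
  moreover have "card J = 2 * card (- ?W - L) + card (L - ?W)"
    unfolding J_def using card_constrained_coordinates[of ?W L]
    by (simp add: card_image inj_on_subset[OF inj_axis2])
  moreover have "CARD('v) = card (?W - L) + card (- ?W - L) + card L"
  proof -
    have "UNIV = ((?W - L) \<union> (- ?W - L)) \<union> L" by auto
    then have "CARD('v) = card (((?W - L) \<union> (- ?W - L)) \<union> L)" by (rule arg_cong)
    also have "\<dots> = card ((?W - L) \<union> (- ?W - L)) + card L" by (intro card_Un_disjoint) auto
    also have "card ((?W - L) \<union> (- ?W - L)) = card (?W - L) + card (- ?W - L)"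
      by (intro card_Un_disjoint) auto
    finally show ?thesis .
  qed
  moreover have "card L = card (L \<inter> ?W) + card (L - ?W)"
    by (subst card_Un_disjoint[symmetric]) (auto intro!: arg_cong[of _ _ card])
  moreover have "DIM((real^2) \<times> real) = 3" "DIM((real^2)^'v) = 2 * CARD('v)" by simp_all
  ultimately show ?thesis by linarith
qed

text \<open>For u along the line, x . perp u is constant on S, so the similarity with coordinates x
  . u and x . perp u makes the line horizontal.\<close>

lemma collinear_straighten:
  fixes S :: "(real^2) set"
  assumes "collinear S"
  shows "\<exists>(f :: real^2 \<Rightarrow> real^2) \<kappa>. linear f \<and> (\<forall>x. f x = 0 \<longrightarrow> x = 0) \<and> (\<forall>x\<in>S. f x $ 2 = \<kappa>)"
proof -
  obtain w where w: "\<And>x y. x \<in> S \<Longrightarrow> y \<in> S \<Longrightarrow> \<exists>c. x - y = c *\<^sub>R w"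
    using assms by (auto simp: collinear_def)
  \<comment> \<open>If w = 0 then S has at most one point and any nonzero direction will do.\<close>
  define u where "u = (if w = 0 then axis 1 1 else w)"
  have u0: "u \<noteq> 0" by (simp add: u_def axis_eq_0_iff)
  define f :: "real^2 \<Rightarrow> real^2" where "f x = (\<chi> k. if k = 1 then x \<bullet> u else x \<bullet> perp u)" for x
  have diff: "x \<bullet> perp u = y \<bullet> perp u" if "x \<in> S" "y \<in> S" for x y
  proof -
    obtain c where "x - y = c *\<^sub>R w" using w \<open>x \<in> S\<close> \<open>y \<in> S\<close> by blast
    then have "(x - y) \<bullet> perp u = 0" by (auto simp: u_def inner_2)
    then show ?thesis by (simp add: inner_diff_left)
  qed
  show ?thesis
  proof (intro exI[of _ f] exI[of _ "(SOME x. x \<in> S) \<bullet> perp u"] conjI allI impI ballI)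
    show "linear f"
      by (rule linearI) (auto simp: f_def vec_eq_iff inner_add_left)
    show "x = 0" if "f x = 0" for x
    proof -
      have 1: "x $ 1 * u $ 1 + x $ 2 * u $ 2 = 0" "x $ 2 * u $ 1 - x $ 1 * u $ 2 = 0"
        using that by (auto simp: f_def vec_eq_2 inner_2)
      have "x $ 1 * ((u $ 1)\<^sup>2 + (u $ 2)\<^sup>2) = 0" "x $ 2 * ((u $ 1)\<^sup>2 + (u $ 2)\<^sup>2) = 0"
        using 1 by algebra+
      moreover have "(u $ 1)\<^sup>2 + (u $ 2)\<^sup>2 \<noteq> 0"
        using u0 by (simp add: vec_eq_2 sum_power2_eq_zero_iff)
      ultimately show ?thesis by (auto simp: vec_eq_2)
    qed
    show "f x $ 2 = (SOME x. x \<in> S) \<bullet> perp u" if "x \<in> S" for x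
      using diff[OF that someI[of "\<lambda>x. x \<in> S", OF that]] by (simp add: f_def)
  qed
qed

text \<open>Rows are linear in differences of positions, so f applied at every vertex carries rows
  to rows, and the translation onto the axis cancels.\<close>

lemma indep_bar_row_straighten:
  fixes q :: "'v::finite \<Rightarrow> real^2"
  assumes col: "collinear (q ` L)" and ind: "indep_family H (bar_row q)"
  obtains q' where "indep_family H (bar_row q')" "\<And>u. u \<in> L \<Longrightarrow> q' u $ 2 = 0"
proof -
  from collinear_straighten[OF col] obtain f :: "real^2 \<Rightarrow> real^2" and \<kappa>
    where f: "linear f" "\<forall>x. f x = 0 \<longrightarrow> x = 0" "\<forall>x\<in>q ` L. f x $ 2 = \<kappa>"
    by blast
  define \<Phi> :: "(real^2)^'v \<Rightarrow> (real^2)^'v" where "\<Phi> v = (\<chi> u. f (v $ u))" for v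
  define q' where "q' u = f (q u) - axis 2 \<kappa>" for u
  have \<Phi>_nth: "\<Phi> v $ u = f (v $ u)" for v u by (simp add: \<Phi>_def)
  have lin: "linear \<Phi>"
  proof (rule linearI)
    show "\<Phi> (v + w) = \<Phi> v + \<Phi> w" for v w
      by (rule vec_eqI) (simp add: \<Phi>_nth linear_add[OF f(1)])
    show "\<Phi> (r *\<^sub>R v) = r *\<^sub>R \<Phi> v" for r v
      by (rule vec_eqI) (simp add: \<Phi>_nth linear_scale[OF f(1)])
  qed
  have inj: "v = 0" if "\<Phi> v = 0" for v
  proof (rule vec_eqI)
    show "v $ u = 0 $ u" for u
      using f(2) arg_cong[OF that, of "\<lambda>v. v $ u"] by (simp add: \<Phi>_nth)
  qed
  have "indep_family H (\<lambda>e. \<Phi> (bar_row q e))"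
    by (rule indep_family_linear_image[OF lin inj ind])
  moreover have "\<Phi> (bar_row q e) = bar_row q' e" for e
  proof -
    have axis: "\<Phi> (axis u a) = axis u (f a)" for u a
      by (rule vec_eqI) (simp add: \<Phi>_nth axis_def linear_0[OF f(1)])
    show ?thesis
      by (simp add: bar_row_def linear_diff[OF lin] axis linear_diff[OF f(1)] q'_def)
  qed
  ultimately have "indep_family H (bar_row q')" by simp
  moreover have "q' u $ 2 = 0" if "u \<in> L" for u using f(3) that by (simp add: q'_def axis_def)
  ultimately show thesis by (rule that)
qed

section \<open>Fixed-normal motions\<close>

text \<open>An edge between two lines imposes no equation, hence the row 0; independence of the rows
  thereby excludes such edges.\<close>

definition fixed_normal_row ::
  "('p \<Rightarrow> real^2) \<Rightarrow> ('l \<Rightarrow> real^2) \<Rightarrow> ('p::finite + 'l::finite) set \<Rightarrow> ((real^2)^'p) \<times> (real^'l)" where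
  "fixed_normal_row p a e =
     (case tail e of
        Inl i \<Rightarrow> (case head e of
            Inl k \<Rightarrow> (axis i (p i - p k) - axis k (p i - p k), 0)
          | Inr j \<Rightarrow> (axis i (a j), axis j 1))
      | Inr j \<Rightarrow> (case head e of
            Inl i \<Rightarrow> (axis i (a j), axis j 1)
          | Inr k \<Rightarrow> 0))"

lemma fixed_normal_row_inner:
  "fixed_normal_row p a e \<bullet> v =
     (case tail e of
        Inl i \<Rightarrow> (case head e of
            Inl k \<Rightarrow> (p i - p k) \<bullet> (fst v $ i - fst v $ k)
          | Inr j \<Rightarrow> fst v $ i \<bullet> a j + snd v $ j)
      | Inr j \<Rightarrow> (case head e of
            Inl i \<Rightarrow> fst v $ i \<bullet> a j + snd v $ j
          | Inr k \<Rightarrow> 0))"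
  by (simp add: fixed_normal_row_def inner_prod_def inner_diff_left inner_diff_right
      inner_axis' inner_commute[of "a _"] split: sum.split)

lemma fixed_normal_motions_eq:
  assumes "simple_graph UNIV E"
  shows "fixed_normal_motions E p l = {v. \<forall>e\<in>E. fixed_normal_row p (fst \<circ> l) e \<bullet> v = 0}"
proof (intro set_eqI iffI)
  fix v assume "v \<in> fixed_normal_motions E p l"
  then have v: "{Inl i, Inl k} \<in> E \<Longrightarrow> (p i - p k) \<bullet> (fst v $ i - fst v $ k) = 0"
    "{Inl i, Inr j} \<in> E \<Longrightarrow> fst v $ i \<bullet> fst (l j) + snd v $ j = 0" for i k j
    by (auto simp: fixed_normal_motions_def)
  have "fixed_normal_row p (fst \<circ> l) e \<bullet> v = 0" if e: "e \<in> E" for e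
  proof -
    have ends: "{tail e, head e} \<in> E"
      using assms e edge_ends(1)[of e] by (simp add: simple_graph_def)
    show ?thesis
    proof (cases "tail e"; cases "head e")
      fix i k assume 1: "tail e = Inl i" "head e = Inl k"
      then show ?thesis using v(1)[of i k] ends by (simp add: fixed_normal_row_inner)
    next
      fix i j assume 1: "tail e = Inl i" "head e = Inr j"
      then show ?thesis using v(2)[of i j] ends by (simp add: fixed_normal_row_inner)
    next
      fix i j assume 1: "tail e = Inr j" "head e = Inl i"
      then show ?thesis using v(2)[of i j] ends by (simp add: fixed_normal_row_inner insert_commute)
    next
      fix i j assume 1: "tail e = Inr j" "head e = Inr i"
      then show ?thesis by (simp add: fixed_normal_row_inner)
    qed
  qed
  then show "v \<in> {v. \<forall>e\<in>E. fixed_normal_row p (fst \<circ> l) e \<bullet> v = 0}" by blast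
next
  fix v assume "v \<in> {v. \<forall>e\<in>E. fixed_normal_row p (fst \<circ> l) e \<bullet> v = 0}"
  then have v: "fixed_normal_row p (fst \<circ> l) e \<bullet> v = 0" if "e \<in> E" for e using that by blast
  have "(p i - p k) \<bullet> (fst v $ i - fst v $ k) = 0" if e: "{Inl i, Inl k} \<in> E" for i k
  proof -
    have c: "card {Inl i, Inl k :: 'a + 'b} = 2" using assms e by (auto simp: simple_graph_def)
    show ?thesis
      using v[OF e] by (cases rule: edge_endsE[OF c refl])
        (simp_all add: fixed_normal_row_inner inner_diff_left inner_diff_right)
  qed
  moreover have "fst v $ i \<bullet> fst (l j) + snd v $ j = 0" if e: "{Inl i, Inr j} \<in> E" for i j
  proof -
    have c: "card {Inl i, Inr j :: 'a + 'b} = 2" using assms e by (auto simp: simple_graph_def)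
    show ?thesis
      using v[OF e] by (cases rule: edge_endsE[OF c refl]) (simp_all add: fixed_normal_row_inner)
  qed
  ultimately show "v \<in> fixed_normal_motions E p l"
    by (cases v) (auto simp: fixed_normal_motions_def)
qed

section \<open>Counting covered vertices\<close>

lemma nu_eq: "nu Y F = card (Y \<inter> \<Union>F)"
  unfolding nu_def by (rule arg_cong[of _ _ card]) auto

lemma nu_Inl: "nu V_P F = card {i. Inl i \<in> \<Union>F}"
proof -
  have "V_P \<inter> \<Union>F = Inl ` {i. Inl i \<in> \<Union>F}" by auto
  then show ?thesis unfolding nu_eq by (simp add: card_image)
qed

lemma nu_Inr: "nu V_L F = card {j. Inr j \<in> \<Union>F}"
proof -
  have "V_L \<inter> \<Union>F = Inr ` {j. Inr j \<in> \<Union>F}" by auto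
  then show ?thesis unfolding nu_eq by (simp add: card_image)
qed

lemma card_incident_vertices: "card (\<Union>F) = nu V_P F + nu V_L F"
  for F :: "('p::finite + 'l::finite) set set"
proof -
  have "\<Union>F = (V_P \<inter> \<Union>F) \<union> (V_L \<inter> \<Union>F)"
    using UNIV_sum by (metis Int_Un_distrib2 inf_top_left)
  then have "card (\<Union>F) = card ((V_P \<inter> \<Union>F) \<union> (V_L \<inter> \<Union>F))" by (rule arg_cong)
  also have "\<dots> = nu V_P F + nu V_L F" unfolding nu_eq by (intro card_Un_disjoint) auto
  finally show ?thesis .
qed

text \<open>Only translations are trivial, because a rotation would turn the normals: covered points
  move by t, offsets of covered lines by -(t . a). The two parameters of t are the 2 of the
  bound.\<close>

lemma fixed_normal_count:
  fixes F :: "('p::finite + 'l::finite) set set"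
  assumes ind: "indep_family F (fixed_normal_row p a)" and ne: "F \<noteq> {}" and F: "simple_graph UNIV F"
  shows "card F + 2 \<le> 2 * nu V_P F + nu V_L F"
proof -
  let ?A = "{i. Inl i \<in> \<Union>F}" and ?B = "{j. Inr j \<in> \<Union>F}"
  define \<tau> :: "real^2 \<Rightarrow> ((real^2)^'p) \<times> (real^'l)" where
    "\<tau> t = (\<chi> i. if i \<in> ?A then t else 0, \<chi> j. if j \<in> ?B then - (t \<bullet> a j) else 0)" for t
  define J1 where "J1 = (\<lambda>(i, k :: 2). (axis i (axis k 1), 0) :: ((real^2)^'p) \<times> (real^'l)) ` ((- ?A) \<times> UNIV)"
  define J2 where "J2 = (\<lambda>j. (0, axis j 1) :: ((real^2)^'p) \<times> (real^'l)) ` (- ?B)"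
  have c2: "card e = 2" if "e \<in> F" for e using F that by (simp add: simple_graph_def)
  have ends: "tail e \<in> \<Union>F" "head e \<in> \<Union>F" if "e \<in> F" for e
    using edge_ends(1)[OF c2[OF that]] that by blast+
  have row: "fixed_normal_row p a e \<bullet> v = 0"
    if e: "e \<in> F" and v: "(\<forall>i\<in>?A. fst v $ i = t) \<and> (\<forall>j\<in>?B. snd v $ j = - (t \<bullet> a j))" for e v t
    using ends[OF e] v
    by (cases "tail e"; cases "head e") (simp_all add: fixed_normal_row_inner)
  have "card F + DIM(real^2) + card (J1 \<union> J2) \<le> DIM(((real^2)^'p) \<times> (real^'l))"
  proof (rule indep_family_card_bound[OF _ ind, where \<tau> = \<tau>])
    show "linear \<tau>"
    proof (rule linearI)
      show "\<tau> (s + t) = \<tau> s + \<tau> t" for s t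
        by (auto simp: \<tau>_def vec_eq_iff inner_add_left)
      show "\<tau> (r *\<^sub>R t) = r *\<^sub>R \<tau> t" for r t
        by (auto simp: \<tau>_def vec_eq_iff)
    qed
    show "t = 0" if t: "\<tau> t = 0" for t
    proof -
      obtain e where e: "e \<in> F" using ne by blast
      \<comment> \<open>A translation along all covered lines changes no offset, so injectivity of
        \<open>\<tau>\<close> needs a covered point.\<close>
      have "\<exists>i. i \<in> ?A"
      proof (rule ccontr)
        assume "\<nexists>i. i \<in> ?A"
        then obtain j k where "tail e = Inr j" "head e = Inr k"
          using ends[OF e] by (cases "tail e"; cases "head e") auto
        then have "fixed_normal_row p a e = 0" by (simp add: fixed_normal_row_def)
        then show False using indep_family_nonzero[OF ind e] by simp
      qed
      then obtain i where i: "i \<in> ?A" by blast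
      have "fst (\<tau> t) $ i = 0" using t by (simp add: zero_prod_def)
      then show "t = 0" using i by (simp add: \<tau>_def)
    qed
    show "J1 \<union> J2 \<subseteq> Basis"
      by (auto simp: J1_def J2_def Basis_prod_def)
    show "fixed_normal_row p a e \<bullet> \<tau> t = 0" if "e \<in> F" for e t
      using that by (rule row[of _ _ t]) (simp add: \<tau>_def)
    show "fixed_normal_row p a e \<bullet> b = 0" if e: "e \<in> F" and b: "b \<in> J1 \<union> J2" for e b
      using e by (rule row[of _ _ 0]) (use b in \<open>auto simp: J1_def J2_def axis_def\<close>)
    show "\<tau> t \<bullet> b = 0" if "b \<in> J1 \<union> J2" for t b
      using that by (auto simp: J1_def J2_def \<tau>_def inner_prod_def inner_axis split: if_splits)
  qed simp
  moreover have "card (J1 \<union> J2) = 2 * card (- ?A) + card (- ?B)"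
  proof -
    have "card (J1 \<union> J2) = card J1 + card J2"
      by (intro card_Un_disjoint) (auto simp: J1_def J2_def axis_eq_0_iff)
    moreover have "card J1 = card ((- ?A) \<times> (UNIV :: 2 set))"
      unfolding J1_def by (intro card_image) (auto simp: inj_on_def axis_eq_axis)
    moreover have "card J2 = card (- ?B)"
      unfolding J2_def by (intro card_image) (auto simp: inj_on_def axis_eq_axis)
    ultimately show ?thesis by (simp add: card_cartesian_product)
  qed
  moreover have "card (- ?A) + card ?A = CARD('p)" "card (- ?B) + card ?B = CARD('l)"
    by (subst card_Un_disjoint[symmetric]; simp add: Compl_partition2)+
  moreover have "DIM(((real^2)^'p) \<times> (real^'l)) = 2 * CARD('p) + CARD('l)" "DIM(real^2) = 2"
    by simp_all
  ultimately show ?thesis unfolding nu_Inl nu_Inr by linarith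
qed

text \<open>The two inequalities of (c), with the subtractions moved across so that they can be
  stated over the natural numbers.\<close>

definition sparse_graph :: "('p::finite + 'l::finite) set set \<Rightarrow> bool" where
  "sparse_graph E \<longleftrightarrow>
     (\<forall>F. F \<noteq> {} \<and> F \<subseteq> E \<and> nu V_L F = 0 \<longrightarrow> card F + 3 \<le> 2 * nu V_P F) \<and>
     (\<forall>F. F \<noteq> {} \<and> F \<subseteq> E \<longrightarrow> card F + 2 \<le> 2 * nu V_P F + nu V_L F)"

section \<open>Necessity of the counts\<close>

lemma simple_graph_mono: "simple_graph V E \<Longrightarrow> F \<subseteq> E \<Longrightarrow> V \<subseteq> W \<Longrightarrow> simple_graph W F"
  by (auto simp: simple_graph_def)

text \<open>The case of \<open>bar_joint_count\<close> in which L and T are empty; the 3 counts two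
  translations and a rotation.\<close>

lemma bar_row_count:
  fixes F :: "('p::finite + 'l::finite) set set"
  assumes "indep_family F (bar_row q)" "F \<noteq> {}" "simple_graph UNIV F" "nu V_L F = 0"
  shows "card F + 3 \<le> 2 * nu V_P F"
  using bar_joint_count[of F "{}" q "{}"] assms
  by (simp add: card_incident_vertices simple_graph_def)

text \<open>Edges between points form a bar-joint framework, where rotations are trivial too; this
  third parameter sharpens 2 to 3.\<close>

lemma fixed_normal_rigid_imp_sparse:
  fixes E :: "('p::finite + 'l::finite) set set"
  assumes sg: "simple_graph UNIV E" and rig: "min_inf_fixed_normal_rigid E p l"
  shows "card E + 2 = 2 * CARD('p) + CARD('l) \<and> sparse_graph E"
proof -
  let ?r = "fixed_normal_row p (fst \<circ> l)"
  have motions: "fixed_normal_motions F p l = {v. \<forall>e\<in>F. ?r e \<bullet> v = 0}" if "F \<subseteq> E" for F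
    using simple_graph_mono[OF sg that order_refl] by (rule fixed_normal_motions_eq)
  have ind: "indep_family E ?r" and card: "card E + 2 = DIM(((real^2)^'p) \<times> (real^'l))"
    using rig motions[of E] motions[of "E - {_}"]
      indep_family_of_minimal[where H = E and x = ?r and k = 2]
    unfolding min_inf_fixed_normal_rigid_def inf_fixed_normal_rigid_def by auto
  have indF: "indep_family F ?r" if "F \<subseteq> E" for F
    using indep_family_subset[OF ind that] by simp
  have "card F + 2 \<le> 2 * nu V_P F + nu V_L F" if "F \<noteq> {}" "F \<subseteq> E" for F
    using fixed_normal_count[OF indF[OF that(2)] that(1)] simple_graph_mono[OF sg that(2) order_refl] .
  moreover have "card F + 3 \<le> 2 * nu V_P F" if F: "F \<noteq> {}" "F \<subseteq> E" "nu V_L F = 0" for F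
  proof -
    \<comment> \<open>R forgets the lines; on an edge between two points it maps the bar-joint row
      to the fixed-normal row.\<close>
    define R :: "(real^2)^('p + 'l) \<Rightarrow> ((real^2)^'p) \<times> (real^'l)" where "R v = (\<chi> i. v $ Inl i, 0)" for v
    define q where "q = case_sum p (\<lambda>_ :: 'l. 0)"
    have "linear R" by (rule linearI) (auto simp: R_def vec_eq_iff)
    moreover have "indep_family F (\<lambda>e. R (bar_row q e)) \<longleftrightarrow> indep_family F ?r"
    proof -
      have "R (bar_row q e) = ?r e" if e: "e \<in> F" for e
      proof -
        have noline: "Inr j \<notin> \<Union>F" for j :: 'l using F(3) by (auto simp: nu_Inr)
        have "card e = 2" using sg F(2) e by (auto simp: simple_graph_def)
        then have "tail e \<in> \<Union>F" "head e \<in> \<Union>F" using edge_ends(1) e by blast+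
        then obtain i k where ik: "tail e = Inl i" "head e = Inl k"
          using noline by (metis sum.exhaust)
        show ?thesis
          by (auto simp: R_def bar_row_def fixed_normal_row_def ik q_def vec_eq_iff axis_def)
      qed
      then show ?thesis unfolding indep_family_def by (simp cong: sum.cong)
    qed
    ultimately have "indep_family F (bar_row q)"
      using indF[OF F(2)] indep_family_linear_preimage by blast
    then show ?thesis using F simple_graph_mono[OF sg F(2) order_refl] by (intro bar_row_count)
  qed
  ultimately show ?thesis using card by (auto simp: sparse_graph_def)
qed

text \<open>The count is applied to F together with all of T. The \<open>CARD('l) - 1\<close> tree
  edges cancel the term \<open>card L\<close> of \<open>bar_joint_count\<close> up to 1, which
  lowers the 3 there to 2.\<close>

lemma bar_joint_rigid_imp_sparse:
  fixes E T :: "('p::finite + 'l::finite) set set"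
  assumes sg: "simple_graph UNIV E" and tree: "is_tree V_L T" and dis: "E \<inter> T = {}"
    and rig: "min_inf_rigid (E \<union> T) q" and col: "collinear (q ` V_L)"
  shows "card E + 2 = 2 * CARD('p) + CARD('l) \<and> sparse_graph E"
proof -
  have sgT: "simple_graph V_L T" using tree by (simp add: is_tree_def)
  then have sgET: "simple_graph UNIV (E \<union> T)" using sg by (auto simp: simple_graph_def)
  have motions: "bar_joint_motions H q = {v. \<forall>e\<in>H. bar_row q e \<bullet> v = 0}" if "H \<subseteq> E \<union> T" for H
    using simple_graph_mono[OF sgET that order_refl] by (rule bar_joint_motions_eq)
  have ind: "indep_family (E \<union> T) (bar_row q)" and card: "card (E \<union> T) + 3 = DIM((real^2)^('p + 'l))"
    using rig motions[of "E \<union> T"] motions[of "E \<union> T - {_}"]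
      indep_family_of_minimal[where H = "E \<union> T" and x = "bar_row q" and k = 3]
    unfolding min_inf_rigid_def inf_rigid_def by auto
  have cardL: "card (V_L :: ('p + 'l) set) = CARD('l)" by (simp add: card_image)
  have cardT: "card T + 1 = CARD('l)" using is_tree_card[OF _ tree] cardL by simp
  obtain q' where ind': "indep_family (E \<union> T) (bar_row q')" and q': "\<And>u. u \<in> V_L \<Longrightarrow> q' u $ 2 = 0"
    using indep_bar_row_straighten[OF col ind] by blast
  have union: "card (F \<union> T) = card F + card T" if "F \<subseteq> E" for F
    using dis that by (intro card_Un_disjoint) auto
  have "card F + 2 \<le> 2 * nu V_P F + nu V_L F" if F: "F \<noteq> {}" "F \<subseteq> E" for F
  proof -
    have "indep_family (F \<union> T) (bar_row q')"
      using F(2) by (intro indep_family_subset[OF ind']) auto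
    then have "card (F \<union> T) + 3 \<le> 2 * card (\<Union>F - V_L) + card (V_L \<inter> \<Union>F) + card (V_L :: ('p + 'l) set)"
      using F(1) simple_graph_mono[OF sg F(2) order_refl] sgT q' by (rule bar_joint_count)
    moreover have "\<Union>F - V_L = V_P \<inter> \<Union>F" using UNIV_sum by auto
    ultimately show ?thesis using union[OF F(2)] cardT cardL by (simp add: nu_eq)
  qed
  moreover have "card F + 3 \<le> 2 * nu V_P F" if F: "F \<noteq> {}" "F \<subseteq> E" "nu V_L F = 0" for F
    using F simple_graph_mono[OF sg F(2) order_refl] indep_family_subset[OF ind', of F]
    by (intro bar_row_count) auto
  moreover have "card E + 2 = 2 * CARD('p) + CARD('l)"
    using card union[of E] cardT by simp
  ultimately show ?thesis by (auto simp: sparse_graph_def)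
qed

section \<open>Realising sparse graphs\<close>

definition drop_tangent :: "(real^2)^('p::finite + 'l::finite) \<Rightarrow> (real^2)^('p + 'l)" where
  "drop_tangent v = (\<chi> u. case u of Inl i \<Rightarrow> v $ u | Inr j \<Rightarrow> axis 2 (v $ u $ 2))"

lemma drop_tangent_nth [simp]:
  "drop_tangent v $ Inl i = v $ Inl i" "drop_tangent v $ Inr j = axis 2 (v $ Inr j $ 2)"
  by (simp_all add: drop_tangent_def)

lemma drop_tangent_nth_2 [simp]: "drop_tangent v $ u $ 2 = v $ u $ 2"
  by (cases u) (simp_all add: axis_def)

lemma drop_tangent_nth_zero: "v $ u = 0 \<Longrightarrow> drop_tangent v $ u = 0"
  by (cases u) (simp_all add: axis_eq_0_iff)

lemma linear_drop_tangent: "linear drop_tangent"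
proof (rule linearI)
  show "drop_tangent (v + w) = drop_tangent v + drop_tangent w" for v w :: "(real^2)^('p::finite + 'l::finite)"
  proof (rule vec_eqI)
    show "drop_tangent (v + w) $ u = (drop_tangent v + drop_tangent w) $ u" for u
      by (cases u) (simp_all add: vec_eq_2 axis_def)
  qed
  show "drop_tangent (r *\<^sub>R v) = r *\<^sub>R drop_tangent v" for r and v :: "(real^2)^('p::finite + 'l::finite)"
  proof (rule vec_eqI)
    show "drop_tangent (r *\<^sub>R v) $ u = (r *\<^sub>R drop_tangent v) $ u" for u
      by (cases u) (simp_all add: vec_eq_2 axis_def)
  qed
qed

lemma drop_tangent_inner: "drop_tangent v \<bullet> w = v \<bullet> drop_tangent w"
proof -
  have "drop_tangent v $ u \<bullet> w $ u = v $ u \<bullet> drop_tangent w $ u" for u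
    by (cases u) (simp_all add: inner_axis inner_axis')
  then show ?thesis by (simp add: inner_vec_def[of "drop_tangent v"] inner_vec_def[of v])
qed

text \<open>The projected row of e when its ends differ by the k-th unit vector; k = 1 and k = 2
  together span the plane of e.\<close>

definition edge_vec :: "2 \<Rightarrow> ('p::finite + 'l::finite) set \<Rightarrow> (real^2)^('p + 'l)" where
  "edge_vec k e = drop_tangent (axis (tail e) (axis k 1) - axis (head e) (axis k 1))"

lemma edge_vec_inner:
  "edge_vec k e \<bullet> v = drop_tangent v $ tail e $ k - drop_tangent v $ head e $ k"
  by (simp add: edge_vec_def drop_tangent_inner inner_diff_left inner_axis')

lemma edge_vec_nth_zero: "u \<noteq> tail e \<Longrightarrow> u \<noteq> head e \<Longrightarrow> edge_vec k e $ u = 0"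
  unfolding edge_vec_def by (rule drop_tangent_nth_zero) (simp add: axis_def)

lemma edge_vec_orthogonal:
  assumes "card e = 2" "card f = 2" "e \<inter> f = {}"
  shows "edge_vec k e \<bullet> edge_vec k' f = 0"
proof -
  have "tail e \<noteq> tail f" "tail e \<noteq> head f" "head e \<noteq> tail f" "head e \<noteq> head f"
    using edge_ends(1)[OF assms(1)] edge_ends(1)[OF assms(2)] assms(3) by blast+
  then have "edge_vec k' f $ tail e = 0" "edge_vec k' f $ head e = 0"
    by (simp_all add: edge_vec_nth_zero)
  then show ?thesis by (simp add: edge_vec_inner drop_tangent_nth_zero)
qed

text \<open>If v is orthogonal to both vectors of an edge, \<open>drop_tangent v\<close> agrees at
  its ends, hence by connectedness at all covered vertices. The common value has two free
  components, but one if a vertex of V_L is covered. Connectedness is phrased as the absence of the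
  splitting used for induction in \<open>dim_edge_vecs\<close>.\<close>

lemma dim_edge_vecs_connected:
  fixes F :: "('p::finite + 'l::finite) set set"
  assumes c2: "\<And>e. e \<in> F \<Longrightarrow> card e = 2" and ne: "F \<noteq> {}"
    and conn: "\<And>F1 F2. F1 \<union> F2 = F \<Longrightarrow> \<Union>F1 \<inter> \<Union>F2 = {} \<Longrightarrow> F1 = {} \<or> F2 = {}"
  shows "2 * nu V_P F + nu V_L F \<le>
    dim (edge_vec 1 ` F \<union> edge_vec 2 ` F) + (if nu V_L F = 0 then 2 else 1)"
proof -
  let ?W = "edge_vec 1 ` F \<union> edge_vec 2 ` F"
  \<comment> \<open>The coordinates on which all edge vectors vanish.\<close>
  define I where "I = {(u :: 'p + 'l, k :: 2). u \<notin> \<Union>F \<or> (u \<in> V_L \<and> k = 1)}"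
  define J where "J = (\<lambda>(u, k). axis u (axis k 1) :: (real^2)^('p + 'l)) ` I"
  define one where "one k = (\<chi> u. axis k 1 :: (real^2)^('p + 'l))" for k
  have const: "\<exists>t. \<forall>u\<in>\<Union>F. drop_tangent v $ u = t" if v: "\<forall>s\<in>?W. s \<bullet> v = 0" for v
  proof -
    obtain e0 where e0: "e0 \<in> F" using ne by blast
    define t where "t = drop_tangent v $ tail e0"
    define g where "g e = drop_tangent v $ tail e" for e
    have eq: "drop_tangent v $ u = g e" if e: "e \<in> F" and u: "u \<in> e" for e u
    proof -
      have "edge_vec 1 e \<bullet> v = 0" "edge_vec 2 e \<bullet> v = 0" using v e by blast+
      then have "drop_tangent v $ head e = g e"
        by (simp add: vec_eq_2 edge_vec_inner g_def)
      moreover have "u = tail e \<or> u = head e" using edge_ends(1)[OF c2[OF e]] u by blast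
      ultimately show ?thesis by (auto simp: g_def)
    qed
    have "{e \<in> F. g e = t} \<union> {e \<in> F. g e \<noteq> t} = F" by blast
    moreover have "\<Union>{e \<in> F. g e = t} \<inter> \<Union>{e \<in> F. g e \<noteq> t} = {}"
    proof (rule ccontr)
      assume "\<Union>{e \<in> F. g e = t} \<inter> \<Union>{e \<in> F. g e \<noteq> t} \<noteq> {}"
      then obtain u e f where "u \<in> e" "u \<in> f" "e \<in> F" "f \<in> F" "g e = t" "g f \<noteq> t" by blast
      then show False using eq[of e u] eq[of f u] by simp
    qed
    ultimately have "{e \<in> F. g e = t} = {} \<or> {e \<in> F. g e \<noteq> t} = {}" by (rule conn)
    moreover have "e0 \<in> {e \<in> F. g e = t}" using e0 by (simp add: g_def t_def)
    ultimately have "{e \<in> F. g e \<noteq> t} = {}" by blast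
    then have "\<forall>u\<in>\<Union>F. drop_tangent v $ u = t" using eq by blast
    then show ?thesis by blast
  qed
  have J: "J \<subseteq> Basis" by (auto simp: J_def axis2_in_Basis)
  have inJ: "w \<in> span J" if w: "\<And>u k. (u, k) \<notin> I \<Longrightarrow> w $ u $ k = 0" for w
  proof -
    have "w \<bullet> b = 0" if b: "b \<in> Basis" "b \<notin> J" for b
    proof -
      obtain u k where uk: "b = axis u (axis k 1)"
        using b(1) by (auto simp: Basis_vec_def)
      then have "(u, k) \<notin> I" using b(2) by (auto simp: J_def)
      then show ?thesis using w[of u k] by (simp add: uk inner_axis)
    qed
    then show ?thesis by (auto simp: span_substd_basis[OF J])
  qed
  have notI: "u \<in> \<Union>F \<and> (k = 1 \<longrightarrow> u \<notin> V_L)" if "(u, k) \<notin> I" for u k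
    using that by (auto simp: I_def)
  have card_J: "card J = card I"
    unfolding J_def by (rule card_image[OF inj_on_subset[OF inj_axis2 subset_UNIV]])
  have "dim {v. \<forall>s\<in>?W. s \<bullet> v = 0} \<le> card J + (if nu V_L F = 0 then 2 else 1)"
  proof -
    define G where "G = (if nu V_L F = 0 then {one 1, one 2} else {one 2})"
    have "v \<in> span (J \<union> G)" if v: "\<forall>s\<in>?W. s \<bullet> v = 0" for v
    proof -
      obtain t where t: "\<And>u. u \<in> \<Union>F \<Longrightarrow> drop_tangent v $ u = t" using const[OF v] by blast
      have v_t: "v $ u $ k = t $ k" if uk: "(u, k) \<notin> I" for u k
      proof -
        have "drop_tangent v $ u $ k = t $ k" using t notI[OF uk] by simp
        moreover have "drop_tangent v $ u $ k = v $ u $ k"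
          using notI[OF uk] exhaust_2[of k] by (cases u) auto
        ultimately show ?thesis by simp
      qed
      have t1: "t $ 1 = 0" if "nu V_L F \<noteq> 0"
      proof -
        have "{j. Inr j \<in> \<Union>F} \<noteq> {}" using that unfolding nu_Inr by (metis card.empty)
        then obtain j where "Inr j \<in> \<Union>F" by blast
        from t[OF this] have "t = axis 2 (v $ Inr j $ 2)" by simp
        then show ?thesis by (simp add: axis_def)
      qed
      define z where "z = t $ 1 *\<^sub>R one 1 + t $ 2 *\<^sub>R one 2"
      have "v - z \<in> span J"
      proof (rule inJ)
        fix u k assume "(u, k) \<notin> I"
        then show "(v - z) $ u $ k = 0"
          using v_t[of u k] exhaust_2[of k] by (auto simp: z_def one_def axis_def)
      qed
      then have "v - z \<in> span (J \<union> G)" by (meson span_mono sup_ge1 subsetD)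
      moreover have "z \<in> span (J \<union> G)"
        unfolding z_def
      proof (rule span_add)
        show "t $ 2 *\<^sub>R one 2 \<in> span (J \<union> G)"
          by (intro span_scale span_base) (simp add: G_def)
        show "t $ 1 *\<^sub>R one 1 \<in> span (J \<union> G)"
        proof (cases "nu V_L F = 0")
          case True
          then show ?thesis by (intro span_scale span_base) (simp add: G_def)
        qed (simp add: t1 span_zero)
      qed
      ultimately have "(v - z) + z \<in> span (J \<union> G)" by (rule span_add)
      then show ?thesis by simp
    qed
    then have "dim {v. \<forall>s\<in>?W. s \<bullet> v = 0} \<le> card (J \<union> G)"
      by (intro dim_le_card) (auto simp: J_def G_def)
    also have "\<dots> \<le> card J + card G" by (rule card_Un_le)
    also have "card G \<le> (if nu V_L F = 0 then 2 else 1)"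
      by (simp add: G_def card_insert_le_m1)
    finally show ?thesis by simp
  qed
  moreover have "card I + (2 * nu V_P F + nu V_L F) = 2 * CARD('p + 'l)"
  proof -
    have "- I = {(u, k). u \<notin> - \<Union>F \<and> (u \<in> V_L \<longrightarrow> k = 2)}"
      using exhaust_2 by (fastforce simp: I_def)
    then have "card (- I) = 2 * card (- (- \<Union>F) - V_L) + card (V_L - - \<Union>F)"
      by (simp only: card_constrained_coordinates)
    moreover have "- (- \<Union>F) - V_L = V_P \<inter> \<Union>F" "V_L - - \<Union>F = V_L \<inter> \<Union>F"
      using UNIV_sum by auto
    moreover have "card I + card (- I) = card (UNIV :: (('p + 'l) \<times> 2) set)"
      by (subst card_Un_disjoint[symmetric]) (simp_all add: Compl_partition)
    moreover have "card (UNIV :: (('p + 'l) \<times> 2) set) = 2 * CARD('p + 'l)"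
      by (simp only: card_prod) simp
    ultimately show ?thesis by (simp add: nu_eq)
  qed
  moreover have "dim {v. \<forall>s\<in>?W. s \<bullet> v = 0} + dim ?W = 2 * CARD('p + 'l)"
    using dim_orthogonal_complement[of ?W] by simp
  ultimately show ?thesis using card_J by linarith
qed

text \<open>Vertex-disjoint pieces span orthogonal spaces, so their bounds add up with 1 to spare.
  If F is connected, the deficit 2 or 1 of \<open>dim_edge_vecs_connected\<close> and the required 1
  make up the 3 or 2 of the sparsity count.\<close>

lemma dim_edge_vecs:
  fixes E :: "('p::finite + 'l::finite) set set"
  assumes sg: "simple_graph UNIV E" and sp: "sparse_graph E"
  shows "F \<subseteq> E \<Longrightarrow> F \<noteq> {} \<Longrightarrow> card F + 1 \<le> dim (edge_vec 1 ` F \<union> edge_vec 2 ` F)"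
proof (induction "card F" arbitrary: F rule: less_induct)
  case less
  have c2: "card e = 2" if "e \<in> F" for e using sg less.prems(1) that by (auto simp: simple_graph_def)
  show ?case
  proof (cases "\<exists>F1 F2. F1 \<union> F2 = F \<and> \<Union>F1 \<inter> \<Union>F2 = {} \<and> F1 \<noteq> {} \<and> F2 \<noteq> {}")
    case True
    then obtain F1 F2 where F: "F1 \<union> F2 = F" "\<Union>F1 \<inter> \<Union>F2 = {}" "F1 \<noteq> {}" "F2 \<noteq> {}" by blast
    have disj: "e \<inter> f = {}" if "e \<in> F1" "f \<in> F2" for e f using F(2) that by blast
    have "F1 \<inter> F2 = {}"
    proof (rule ccontr)
      assume "F1 \<inter> F2 \<noteq> {}"
      then obtain e where "e \<in> F1" "e \<in> F2" by blast
      then have "e = {}" "e \<in> F" using disj[of e e] F(1) by auto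
      then show False using c2[of e] by simp
    qed
    then have card: "card F = card F1 + card F2" using F(1) by (metis card_Un_disjoint finite)
    then have "card F1 < card F" "card F2 < card F" using F(3,4) by (simp_all add: card_gt_0_iff)
    then have "card F1 + 1 \<le> dim (edge_vec 1 ` F1 \<union> edge_vec 2 ` F1)"
      "card F2 + 1 \<le> dim (edge_vec 1 ` F2 \<union> edge_vec 2 ` F2)"
      using less.hyps less.prems(1) F by auto
    moreover have "dim ((edge_vec 1 ` F1 \<union> edge_vec 2 ` F1) \<union> (edge_vec 1 ` F2 \<union> edge_vec 2 ` F2)) =
        dim (edge_vec 1 ` F1 \<union> edge_vec 2 ` F1) + dim (edge_vec 1 ` F2 \<union> edge_vec 2 ` F2)"
    proof (rule dim_orthogonal_sum)
      fix x y assume "x \<in> edge_vec 1 ` F1 \<union> edge_vec 2 ` F1" "y \<in> edge_vec 1 ` F2 \<union> edge_vec 2 ` F2"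
      then obtain k e k' f where "x = edge_vec k e" "e \<in> F1" "y = edge_vec k' f" "f \<in> F2" by blast
      then show "x \<bullet> y = 0" using disj c2 F(1) by (auto intro!: edge_vec_orthogonal)
    qed
    moreover have "edge_vec 1 ` F \<union> edge_vec 2 ` F =
        (edge_vec 1 ` F1 \<union> edge_vec 2 ` F1) \<union> (edge_vec 1 ` F2 \<union> edge_vec 2 ` F2)"
      using F(1) by auto
    ultimately show ?thesis using card by simp
  next
    case False
    then have "2 * nu V_P F + nu V_L F \<le>
        dim (edge_vec 1 ` F \<union> edge_vec 2 ` F) + (if nu V_L F = 0 then 2 else 1)"
      using c2 less.prems(2) by (intro dim_edge_vecs_connected) auto
    moreover have "card F + 2 \<le> 2 * nu V_P F + nu V_L F" "nu V_L F = 0 \<Longrightarrow> card F + 3 \<le> 2 * nu V_P F"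
      using sp less.prems by (auto simp: sparse_graph_def)
    ultimately show ?thesis by (auto split: if_splits)
  qed
qed

section \<open>Generic realisations and their motions\<close>

text \<open>The hyperplane with normal \<open>h\<close> encodes a framework \<open>q\<close> with \<open>V_L\<close> on the first coordinate
  axis, and the section of the plane spanned by the two vectors of an edge is its rigidity row.\<close>

lemma sparse_realisation:
  fixes E :: "('p::finite + 'l::finite) set set"
  assumes sg: "simple_graph UNIV E" and sp: "sparse_graph E"
  shows "\<exists>q :: 'p + 'l \<Rightarrow> real^2. indep_family E (\<lambda>e. drop_tangent (bar_row q e)) \<and>
    (\<forall>i. q (Inl i) $ 2 \<noteq> 0) \<and> (\<forall>j. q (Inr j) $ 2 = 0) \<and>
    (\<forall>j k. j \<noteq> k \<longrightarrow> q (Inr j) $ 1 \<noteq> q (Inr k) $ 1)"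
proof -
  \<comment> \<open>D1 keeps the points of V_P off the axis, since the projective map divides by
    their second coordinate; D2 separates the points of V_L, so that bars of T have positive
    length.\<close>
  define D1 where "D1 = (\<lambda>i. axis (Inl i) (axis 1 1) :: (real^2)^('p + 'l)) ` UNIV"
  define D2 where "D2 = (\<lambda>(j, k). axis (Inr j) (axis 2 1) - axis (Inr k) (axis 2 1) :: (real^2)^('p + 'l))
    ` {(j, k). j \<noteq> k}"
  have fin: "finite (D1 \<union> D2)" by (simp add: D1_def D2_def)
  have "0 \<notin> D1" by (auto simp: D1_def axis_eq_0_iff dest: sym)
  moreover have "0 \<notin> D2"
    by (auto simp: D2_def axis_eq_axis dest!: sym[of 0])
  ultimately have nz: "0 \<notin> D1 \<union> D2" by blast
  from generic_plane_cut_independent[OF dim_edge_vecs[OF sg sp] fin nz]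
  obtain h where h: "indep_family E (\<lambda>e. plane_cut (edge_vec 1 e) (edge_vec 2 e) h)"
    and hD: "\<forall>d\<in>D1 \<union> D2. h \<bullet> d \<noteq> 0" by blast
  \<comment> \<open>\<open>plane_cut\<close> pairs each edge vector with the value of h on the other
    one, with a sign: this is a clockwise quarter turn.\<close>
  define q where "q u = - perp (drop_tangent h $ u)" for u
  have "plane_cut (edge_vec 1 e) (edge_vec 2 e) h = drop_tangent (bar_row q e)" for e
  proof -
    let ?d = "q (tail e) - q (head e)"
    have ax: "axis u ?d = ?d $ 1 *\<^sub>R axis u (axis 1 1) + ?d $ 2 *\<^sub>R axis u (axis 2 1)" for u :: "'p + 'l"
      by (rule vec_eqI) (simp add: vec_eq_2 axis_def)
    have "bar_row q e = ?d $ 1 *\<^sub>R (axis (tail e) (axis 1 1) - axis (head e) (axis 1 1)) +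
        ?d $ 2 *\<^sub>R (axis (tail e) (axis 2 1) - axis (head e) (axis 2 1))"
      unfolding bar_row_def ax[of "tail e"] ax[of "head e"] by (simp add: scaleR_right_diff_distrib)
    then have "drop_tangent (bar_row q e) = ?d $ 1 *\<^sub>R edge_vec 1 e + ?d $ 2 *\<^sub>R edge_vec 2 e"
      by (simp only: edge_vec_def linear_add[OF linear_drop_tangent] linear_scale[OF linear_drop_tangent])
    moreover have "h \<bullet> edge_vec 2 e = ?d $ 1" "h \<bullet> edge_vec 1 e = - ?d $ 2"
      by (simp_all add: inner_commute[of h] edge_vec_inner q_def)
    ultimately show ?thesis by (simp only: plane_cut_def scaleR_minus_left diff_minus_eq_add)
  qed
  then have "indep_family E (\<lambda>e. drop_tangent (bar_row q e))" using h by simp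
  moreover have "q (Inl i) $ 2 \<noteq> 0" for i
  proof -
    have "h \<bullet> axis (Inl i) (axis 1 1) \<noteq> 0" using hD by (auto simp: D1_def)
    then show ?thesis by (simp add: q_def inner_axis)
  qed
  moreover have "q (Inr j) $ 2 = 0" for j by (simp add: q_def axis_def)
  moreover have "q (Inr j) $ 1 \<noteq> q (Inr k) $ 1" if "j \<noteq> k" for j k
  proof -
    have "h \<bullet> (axis (Inr j) (axis 2 1) - axis (Inr k) (axis 2 1)) \<noteq> 0"
      using hD that by (auto simp: D2_def)
    then show ?thesis by (simp add: q_def inner_axis inner_diff_right)
  qed
  ultimately show ?thesis by blast
qed

text \<open>Motions without tangential part at V_L are fixed by \<open>drop_tangent\<close>, so the
  projected rows constrain them like the rows themselves. With the \<open>CARD('l)\<close>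
  conditions on tangential parts there are two fewer independent equations than coordinates. Both
  realisations reduce to this bound.\<close>

lemma dim_normal_motions:
  fixes E :: "('p::finite + 'l::finite) set set"
  assumes ind: "indep_family E (\<lambda>e. drop_tangent (bar_row q e))"
    and card: "card E + 2 = 2 * CARD('p) + CARD('l)"
  shows "dim {v. (\<forall>j. v $ Inr j $ 1 = 0) \<and> (\<forall>e\<in>E. bar_row q e \<bullet> v = 0)} \<le> 2"
proof -
  let ?X = "(\<lambda>e. drop_tangent (bar_row q e)) ` E"
  define Y where "Y = (\<lambda>j. axis (Inr j) (axis 1 1) :: (real^2)^('p + 'l)) ` UNIV"
  have "dim Y = card Y"
    by (intro dim_eq_card_independent independent_mono[OF independent_Basis])
      (auto simp: Y_def axis2_in_Basis)
  also have "card Y = CARD('l)"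
    unfolding Y_def by (intro card_image) (auto simp: inj_on_def axis_eq_axis)
  finally have Y: "dim Y = CARD('l)" .
  have "dim (?X \<union> Y) = dim ?X + dim Y"
    by (rule dim_orthogonal_sum) (auto simp: Y_def inner_axis inner_axis_axis axis_def[of 2])
  moreover have "dim ?X = card E" by (rule indep_family_dim[OF finite ind])
  moreover have "{v. (\<forall>j. v $ Inr j $ 1 = 0) \<and> (\<forall>e\<in>E. bar_row q e \<bullet> v = 0)}
      \<subseteq> {v. \<forall>s\<in>?X \<union> Y. s \<bullet> v = 0}"
  proof safe
    fix v :: "(real^2)^('p + 'l)"
    assume v: "\<forall>j. v $ Inr j $ 1 = 0" "\<forall>e\<in>E. bar_row q e \<bullet> v = 0"
    have "drop_tangent v = v"
    proof (rule vec_eqI)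
      show "drop_tangent v $ u = v $ u" for u
        using v(1) by (cases u) (simp_all add: vec_eq_2 axis_def)
    qed
    then show "drop_tangent (bar_row q e) \<bullet> v = 0" if "e \<in> E" for e
      using v(2) that by (simp add: drop_tangent_inner)
    show "s \<bullet> v = 0" if "s \<in> Y" for s using that v(1) by (auto simp: Y_def inner_axis')
  qed
  then have "dim {v. (\<forall>j. v $ Inr j $ 1 = 0) \<and> (\<forall>e\<in>E. bar_row q e \<bullet> v = 0)}
      \<le> dim {v. \<forall>s\<in>?X \<union> Y. s \<bullet> v = 0}" by (rule dim_subset)
  ultimately show ?thesis
    using dim_orthogonal_complement[of "?X \<union> Y"] Y card by simp
qed

text \<open>A single edge inside V_L covers no point and two lines, and already 1 + 2 exceeds
  2.\<close>

lemma sparse_imp_disjoint_tree: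
  fixes E T :: "('p::finite + 'l::finite) set set"
  assumes sp: "sparse_graph E" and T: "simple_graph V_L T"
  shows "E \<inter> T = {}"
proof (rule ccontr)
  assume "E \<inter> T \<noteq> {}"
  then obtain e where e: "e \<in> E" "e \<in> T" by blast
  then have "card e = 2" "e \<subseteq> V_L" using T by (auto simp: simple_graph_def)
  moreover have "V_L \<inter> e = e" "V_P \<inter> e = {}" using \<open>e \<subseteq> V_L\<close> by auto
  moreover have "card {e} + 2 \<le> 2 * nu V_P {e} + nu V_L {e}"
    using sp[unfolded sparse_graph_def, THEN conjunct2, rule_format, of "{e}"] e(1) by simp
  ultimately show False by (simp add: nu_eq)
qed

text \<open>The bars of T lie along the axis and have positive length, so they equalise the
  tangential velocities of V_L. Subtracting a translation along the axis leaves a motion in K, which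
  gives at most 2 + 1 dimensions.\<close>

lemma sparse_imp_bar_joint_rigid:
  fixes E T :: "('p::finite + 'l::finite) set set"
  assumes sg: "simple_graph UNIV E" and tree: "is_tree V_L T" and sp: "sparse_graph E"
    and card: "card E + 2 = 2 * CARD('p) + CARD('l)"
  shows "\<exists>q :: 'p + 'l \<Rightarrow> real^2. min_inf_rigid (E \<union> T) q \<and> collinear (q ` V_L)"
proof -
  obtain q :: "'p + 'l \<Rightarrow> real^2" where ind: "indep_family E (\<lambda>e. drop_tangent (bar_row q e))"
    and q2: "\<And>j. q (Inr j) $ 2 = 0" and q1: "\<And>j k. j \<noteq> k \<Longrightarrow> q (Inr j) $ 1 \<noteq> q (Inr k) $ 1"
    using sparse_realisation[OF sg sp] by blast
  have sgT: "simple_graph V_L T" and conT: "connected_graph V_L T"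
    using tree by (simp_all add: is_tree_def)
  then have sgET: "simple_graph UNIV (E \<union> T)" using sg by (auto simp: simple_graph_def)
  have motions: "bar_joint_motions H q = {v. \<forall>e\<in>H. bar_row q e \<bullet> v = 0}" if "H \<subseteq> E \<union> T" for H
    using simple_graph_mono[OF sgET that order_refl] by (rule bar_joint_motions_eq)
  define K where "K = {v. (\<forall>j. v $ Inr j $ 1 = 0) \<and> (\<forall>e\<in>E. bar_row q e \<bullet> v = 0)}"
  define shift :: "(real^2)^('p + 'l)" where "shift = (\<chi> u. axis 1 1)"
  have "v \<in> span (insert shift K)" if v: "v \<in> bar_joint_motions (E \<union> T) q" for v
  proof -
    have row: "bar_row q e \<bullet> v = 0" if "e \<in> E \<union> T" for e
      using v motions[OF order_refl] that by blast
    have step: "v $ x $ 1 = v $ y $ 1" if xy: "{x, y} \<in> T" for x y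
    proof -
      have "{x, y} \<subseteq> V_L" using bspec[OF sgT[unfolded simple_graph_def] xy] by (rule conjunct1)
      then obtain j k where jk: "x = Inr j" "y = Inr k" by blast
      have "j \<noteq> k" using sgT xy by (auto simp: simple_graph_def jk)
      have "(q x - q y) \<bullet> (v $ x - v $ y) = 0" using v xy by (auto simp: bar_joint_motions_def)
      then show ?thesis using q1[OF \<open>j \<noteq> k\<close>] by (simp add: inner_2 jk q2)
    qed
    have const: "v $ Inr j $ 1 = v $ Inr k $ 1" for j k
    proof -
      have "(Inr j, Inr k) \<in> {(x, y). {x, y} \<in> T}\<^sup>*" using conT by (simp add: connected_graph_def)
      then show ?thesis by (induction rule: rtrancl_induct) (simp_all add: step)
    qed
    define s where "s = v $ Inr undefined $ 1"
    have "v - s *\<^sub>R shift \<in> K"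
      unfolding K_def
    proof (intro CollectI conjI allI ballI)
      show "(v - s *\<^sub>R shift) $ Inr j $ 1 = 0" for j
        using const[of j undefined] by (simp add: shift_def s_def axis_def)
      show "bar_row q e \<bullet> (v - s *\<^sub>R shift) = 0" if "e \<in> E" for e
        using row[of e] that by (simp add: inner_diff_right) (simp add: bar_row_inner shift_def)
    qed
    then have "(v - s *\<^sub>R shift) + s *\<^sub>R shift \<in> span (insert shift K)"
      by (intro span_add span_scale) (auto intro: span_base)
    then show ?thesis by simp
  qed
  then have "dim (bar_joint_motions (E \<union> T) q) \<le> dim (insert shift K)"
    by (intro dim_mono) auto
  also have "\<dots> \<le> dim K + 1" by (simp add: dim_insert)
  also have "\<dots> \<le> 3" using dim_normal_motions[OF ind card] by (simp add: K_def)
  finally have le: "dim {v. \<forall>e\<in>E \<union> T. bar_row q e \<bullet> v = 0} \<le> 3" by (simp only: motions[OF order_refl])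
  have cardL: "card (V_L :: ('p + 'l) set) = CARD('l)" by (simp add: card_image)
  have "card (E \<union> T) = card E + card T"
    using sparse_imp_disjoint_tree[OF sp sgT] by (intro card_Un_disjoint) auto
  then have "card (E \<union> T) + 3 = DIM((real^2)^('p + 'l))"
    using card is_tree_card[OF _ tree] cardL by simp
  note min = minimal_of_card[OF finite le this]
  have "min_inf_rigid (E \<union> T) q"
    unfolding min_inf_rigid_def inf_rigid_def
    using min motions[OF order_refl] motions[OF Diff_subset] by simp
  moreover have "collinear (q ` V_L)"
    unfolding collinear_def
  proof (intro exI[of _ "axis 1 1"] ballI)
    fix x y assume "x \<in> q ` V_L" "y \<in> q ` V_L"
    then have "x $ 2 = 0" "y $ 2 = 0" using q2 by auto
    then show "\<exists>c. x - y = c *\<^sub>R axis 1 1"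
      by (intro exI[of _ "x $ 1 - y $ 1"]) (simp add: vec_eq_2 axis_def)
  qed
  ultimately show ?thesis by blast
qed

text \<open>The projective map \<open>(x, y) \<mapsto> (x / y, - 1 / y)\<close> sends the first coordinate axis to infinity, so
  the collinear points become line directions; \<open>\<Psi>\<close> is the induced map of infinitesimal motions.\<close>

lemma sparse_imp_fixed_normal_rigid:
  fixes E :: "('p::finite + 'l::finite) set set"
  assumes sg: "simple_graph UNIV E" and sp: "sparse_graph E"
    and card: "card E + 2 = 2 * CARD('p) + CARD('l)"
  shows "\<exists>(p :: 'p \<Rightarrow> real^2) (l :: 'l \<Rightarrow> (real^2) \<times> real).
    point_line_framework E p l \<and> min_inf_fixed_normal_rigid E p l"
proof -
  obtain q :: "'p + 'l \<Rightarrow> real^2" where ind: "indep_family E (\<lambda>e. drop_tangent (bar_row q e))"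
    and y0: "\<And>i. q (Inl i) $ 2 \<noteq> 0" and q2: "\<And>j. q (Inr j) $ 2 = 0"
    using sparse_realisation[OF sg sp] by blast
  define x y z N where "x i = q (Inl i) $ 1" and "y i = q (Inl i) $ 2"
    and "z j = q (Inr j) $ 1" and "N j = sqrt (1 + (z j)\<^sup>2)" for i j
  have y: "y i \<noteq> 0" for i using y0 by (simp add: y_def)
  have N: "N j > 0" for j by (simp add: N_def add_pos_nonneg)
  define p :: "'p \<Rightarrow> real^2" where "p i = (\<chi> k. if k = 1 then x i / y i else - 1 / y i)" for i
  \<comment> \<open>Up to sign the common direction of the images of the lines through
    \<open>q (Inr j)\<close>. A bar to this point at infinity prescribes the distance along a, so a
    is the normal of line j.\<close>
  define a :: "'l \<Rightarrow> real^2" where "a j = (\<chi> k. if k = 1 then - z j / N j else 1 / N j)" for j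
  define l :: "'l \<Rightarrow> (real^2) \<times> real" where "l j = (a j, 0)" for j
  define \<Psi> :: "((real^2)^'p) \<times> (real^'l) \<Rightarrow> (real^2)^('p + 'l)" where
    "\<Psi> v = (\<chi> u. case u of
        Inl i \<Rightarrow> (\<chi> k. if k = 1 then y i * fst v $ i $ 1 else fst v $ i $ 2 - x i * fst v $ i $ 1)
      | Inr j \<Rightarrow> axis 2 (- N j * snd v $ j))" for v
  have \<Psi>_nth: "\<Psi> v $ Inl i $ 1 = y i * fst v $ i $ 1" "\<Psi> v $ Inl i $ 2 = fst v $ i $ 2 - x i * fst v $ i $ 1"
    "\<Psi> v $ Inr j $ 1 = 0" "\<Psi> v $ Inr j $ 2 = - N j * snd v $ j" for v i j
    by (simp_all add: \<Psi>_def axis_def)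
  have q_nth: "q (Inl i) $ 1 = x i" "q (Inl i) $ 2 = y i" "q (Inr j) $ 1 = z j" for i j
    by (simp_all add: x_def y_def z_def)
  have lin: "linear \<Psi>"
  proof (rule linearI)
    show "\<Psi> (v + w) = \<Psi> v + \<Psi> w" for v w
    proof (rule vec_eqI)
      show "\<Psi> (v + w) $ u = (\<Psi> v + \<Psi> w) $ u" for u
        by (cases u) (simp_all add: vec_eq_2 \<Psi>_nth algebra_simps)
    qed
    show "\<Psi> (r *\<^sub>R v) = r *\<^sub>R \<Psi> v" for r v
    proof (rule vec_eqI)
      show "\<Psi> (r *\<^sub>R v) $ u = (r *\<^sub>R \<Psi> v) $ u" for u
        by (cases u) (simp_all add: vec_eq_2 \<Psi>_nth algebra_simps)
    qed
  qed
  have inj: "v = 0" if "\<Psi> v = 0" for v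
  proof -
    have nth: "\<Psi> v $ u $ k = 0" for u k using that by simp
    have "fst v $ i $ 1 = 0" for i using nth[of "Inl i" 1] y by (simp add: \<Psi>_nth)
    moreover from this have "fst v $ i $ 2 = 0" for i using nth[of "Inl i" 2] by (simp add: \<Psi>_nth)
    moreover have "snd v $ j = 0" for j using nth[of "Inr j" 2] N[of j] by (simp add: \<Psi>_nth)
    ultimately have "fst v = 0" "snd v = 0" by (simp_all add: vec_eq_iff[of "fst v"] vec_eq_iff[of "snd v"] vec_eq_2)
    then show ?thesis by (simp add: prod_eq_iff)
  qed
  have motions: "fixed_normal_motions F p l = {v. \<forall>e\<in>F. fixed_normal_row p a e \<bullet> v = 0}" if "F \<subseteq> E" for F
    using fixed_normal_motions_eq[OF simple_graph_mono[OF sg that order_refl], of p l]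
    by (simp add: l_def comp_def)
  define K where "K = {v. (\<forall>j. v $ Inr j $ 1 = 0) \<and> (\<forall>e\<in>E. bar_row q e \<bullet> v = 0)}"
  \<comment> \<open>The factors here and in \<open>pl\<close> are nonzero, so \<Psi> carries
    solutions to solutions.\<close>
  have pp: "(q (Inl i) - q (Inl k)) \<bullet> (\<Psi> v $ Inl i - \<Psi> v $ Inl k) =
      y i * y k * ((p i - p k) \<bullet> (fst v $ i - fst v $ k))" for i k v
    using y by (simp add: inner_2 \<Psi>_nth q_nth p_def) (simp add: field_simps)
  have pl: "(q (Inl i) - q (Inr j)) \<bullet> (\<Psi> v $ Inl i - \<Psi> v $ Inr j) =
      y i * N j * (fst v $ i \<bullet> a j + snd v $ j)" for i j v
    using N[of j] by (simp add: inner_2 \<Psi>_nth q_nth q2 a_def) (simp add: field_simps)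
  \<comment> \<open>An inclusion is enough: \<Psi> is injective, so the dimension is at most 2, and
    the number of edges gives the other bound in \<open>minimal_of_card\<close>.\<close>
  have "\<Psi> ` fixed_normal_motions E p l \<subseteq> K"
  proof (rule image_subsetI)
    fix v assume "v \<in> fixed_normal_motions E p l"
    then have v: "fixed_normal_row p a e \<bullet> v = 0" if "e \<in> E" for e using motions that by blast
    have "bar_row q e \<bullet> \<Psi> v = 0" if e: "e \<in> E" for e
    proof (cases "tail e"; cases "head e")
      fix i k assume "tail e = Inl i" "head e = Inl k"
      then show ?thesis using v[OF e] by (simp add: bar_row_inner pp fixed_normal_row_inner)
    next
      fix i j assume "tail e = Inl i" "head e = Inr j"
      then show ?thesis using v[OF e] by (simp add: bar_row_inner pl fixed_normal_row_inner)
    next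
      fix i j assume ij: "tail e = Inr j" "head e = Inl i"
      have "bar_row q e \<bullet> \<Psi> v = (q (Inl i) - q (Inr j)) \<bullet> (\<Psi> v $ Inl i - \<Psi> v $ Inr j)"
        by (simp add: bar_row_inner ij inner_diff_left inner_diff_right)
      then show ?thesis using v[OF e] by (simp add: ij pl fixed_normal_row_inner)
    next
      fix j k assume "tail e = Inr j" "head e = Inr k"
      then show ?thesis by (simp add: bar_row_inner inner_2 \<Psi>_nth q2)
    qed
    then show "\<Psi> v \<in> K" by (simp add: K_def \<Psi>_nth)
  qed
  then have "dim (\<Psi> ` fixed_normal_motions E p l) \<le> dim K" by (rule dim_subset)
  moreover have "inj \<Psi>" using lin inj by (simp add: linear_injective_0)
  then have "inj_on \<Psi> (span (fixed_normal_motions E p l))" by (rule inj_on_subset) simp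
  then have "dim (\<Psi> ` fixed_normal_motions E p l) = dim (fixed_normal_motions E p l)"
    by (rule dim_image_eq[OF lin])
  ultimately have "dim (fixed_normal_motions E p l) \<le> 2"
    using dim_normal_motions[OF ind card] by (simp add: K_def)
  then have le: "dim {v. \<forall>e\<in>E. fixed_normal_row p a e \<bullet> v = 0} \<le> 2"
    by (simp only: motions[OF order_refl])
  have "card E + 2 = DIM(((real^2)^'p) \<times> (real^'l))" using card by simp
  note min = minimal_of_card[OF finite le this]
  have "min_inf_fixed_normal_rigid E p l"
    unfolding min_inf_fixed_normal_rigid_def inf_fixed_normal_rigid_def
    using min motions[OF order_refl] motions[OF Diff_subset] by simp
  moreover have "norm (a j) = 1" for j
  proof -
    have "1 + (z j)\<^sup>2 = (N j)\<^sup>2" by (simp add: N_def)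
    moreover have "a j \<bullet> a j = (1 + (z j)\<^sup>2) / (N j)\<^sup>2"
      by (simp add: inner_2 a_def power2_eq_square add_divide_distrib)
    ultimately have "a j \<bullet> a j = 1" using N[of j] by simp
    then show ?thesis by (simp add: norm_eq_sqrt_inner)
  qed
  then have "point_line_framework E p l" using sg by (simp add: point_line_framework_def l_def)
  ultimately show ?thesis by blast
qed

theorem theorem4p2:
  fixes E T :: "('p::finite + 'l::finite) set set"
  assumes "simple_graph (V_P \<union> V_L) E"
    and "card (V_P :: ('p + 'l) set) \<ge> 1"
    and "card (V_L :: ('p + 'l) set) \<ge> 2"
    and "is_tree V_L T"
  shows
    "((\<exists>(p :: 'p \<Rightarrow> real^2) (l :: 'l \<Rightarrow> (real^2) \<times> real).
          point_line_framework E p l \<and> min_inf_fixed_normal_rigid E p l)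
        \<longleftrightarrow>
      (E \<inter> T = {} \<and>
        (\<exists>q :: 'p + 'l \<Rightarrow> real^2. min_inf_rigid (E \<union> T) q \<and> collinear (q ` V_L))))
     \<and>
     ((E \<inter> T = {} \<and>
        (\<exists>q :: 'p + 'l \<Rightarrow> real^2. min_inf_rigid (E \<union> T) q \<and> collinear (q ` V_L)))
        \<longleftrightarrow>
      (int (card E) = 2 * int (card (V_P :: ('p + 'l) set)) + int (card (V_L :: ('p + 'l) set)) - 2 \<and>
       (\<forall>F. F \<noteq> {} \<and> F \<subseteq> E \<and> nu V_L F = 0 \<longrightarrow> int (card F) \<le> 2 * int (nu V_P F) - 3) \<and>
       (\<forall>F. F \<noteq> {} \<and> F \<subseteq> E \<longrightarrow> int (card F) \<le> 2 * int (nu V_P F) + int (nu V_L F) - 2)))"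
    (is "(?a \<longleftrightarrow> ?b) \<and> (?b \<longleftrightarrow> ?c)")
proof -
  have sg: "simple_graph UNIV E" using assms(1) by (simp add: simple_graph_def)
  have sgT: "simple_graph V_L T" using assms(4) by (simp add: is_tree_def)
  \<comment> \<open>Each of the three conditions is compared with this form of the counts over the
    natural numbers.\<close>
  let ?s = "card E + 2 = 2 * CARD('p) + CARD('l) \<and> sparse_graph E"
  have c: "?c \<longleftrightarrow> ?s"
  proof -
    have V: "card (V_P :: ('p + 'l) set) = CARD('p)" "card (V_L :: ('p + 'l) set) = CARD('l)"
      by (simp_all add: card_image)
    have "int (card F) \<le> 2 * int (nu V_P F) - 3 \<longleftrightarrow> card F + 3 \<le> 2 * nu V_P F"
      "int (card F) \<le> 2 * int (nu V_P F) + int (nu V_L F) - 2 \<longleftrightarrow> card F + 2 \<le> 2 * nu V_P F + nu V_L F"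
      for F :: "('p + 'l) set set" by linarith+
    moreover have "int (card E) = 2 * int CARD('p) + int CARD('l) - 2 \<longleftrightarrow>
        card E + 2 = 2 * CARD('p) + CARD('l)" by linarith
    ultimately show ?thesis unfolding sparse_graph_def V by simp
  qed
  have a: "?a \<longleftrightarrow> ?s"
    using fixed_normal_rigid_imp_sparse[OF sg] sparse_imp_fixed_normal_rigid[OF sg] by blast
  have b: "?b \<longleftrightarrow> ?s"
    using bar_joint_rigid_imp_sparse[OF sg assms(4)] sparse_imp_bar_joint_rigid[OF sg assms(4)]
      sparse_imp_disjoint_tree[OF _ sgT] by blast
  show ?thesis unfolding a b c by simp
qed

end
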